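(* Consider the decentralized stochastic optimization algorithm with quantized communication described in the context, and suppose that the gradient, connectivity, quantizer and convexity assumptions of the context hold. If the positive sequences $\{\epsilon^k\}$ and $\{\lambda^k\}$ are selected such that $$\sum_{k=1}^{\infty}\epsilon^k\lambda^k=+\infty,\qquad \sum_{k=1}^{\infty}(\epsilon^k)^2<\infty,\qquad \sum_{k=1}^{\infty}\epsilon^k(\lambda^k)^2<\infty,$$ then the algorithm guarantees $$\lim_{t\to\infty}\frac{\sum_{k=0}^t\epsilon^k\lambda^k\,\mathbb{E}\left[\|\nabla f(\bar x^k)\|^2\right]}{\sum_{k=0}^t\epsilon^k\lambda^k}=0\quad\text{and}\quad \lim_{t\to\infty}\frac{\sum_{k=0}^t\epsilon^k\lambda^k\,\mathbb{E}\left[\left\|\frac1m\sum_{i=1}^m\nabla f_i(x_i^k)\right\|^2\right]}{\sum_{k=0}^t\epsilon^k\lambda^k}=0.$$ Moreover, if in addition $\sum_{k=1}^{\infty}(\epsilon^k)^{3/2}\lambda^k<\infty$, then for every $1\le p\le m$, $$\lim_{t\to\infty}\mathbb{E}\left[f\left(\frac{\sum_{k=0}^t\epsilon^k\lambda^k x_p^k}{\sum_{k=0}^t\epsilon^k\lambda^k}\right)\right]=f(x^* ).$$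
   Context: Problem: $m$ agents seek to solve $\min_{x\in\mathbb{R}^d} f(x)$, where $f(x)=\frac1m\sum_{i=1}^m f_i(x)$ and $f_i(x)=\mathbb{E}_{\xi_i\sim\mathcal{D}_i}[F_i(x,\xi_i)]$, with $F_i$ a stochastic loss private to agent $i$ and $\mathcal{D}_i$ the local data distribution. $\|\cdot\|$ is the Euclidean norm. Algorithm: $x_i^0=0$ for all $i$, and for $k\ge 0$ each agent $i$ updates $$x_i^{k+1}=x_i^k+\epsilon^k\sum_{j\in\mathbb{N}_i}w_{ij}\left(\mathcal{Q}(x_j^k)-\mathcal{Q}(x_i^k)\right)-\epsilon^k\lambda^k g_i^k,$$ where $\epsilon^k,\lambda^k>0$ are design parameters, $\mathcal{Q}$ is a stochastic quantizer (the realization $\mathcal{Q}(x_j^k)$ is computed once by agent $j$ at iteration $k$, used by agent $j$ itself and sent to all its neighbors), and $g_i^k=g_i^k(x_i^k,\xi_i)$ is the stochastic gradient of agent $i$ at iteration $k$. The weights satisfy $w_{ij}=w_{ji}\ge 0$, with $w_{ij}>0$ exactly when agents $i$ and $j$ communicate, and $\mathbb{N}_i=\{j: w_{ij}>0\}$. Set $\bar x^k=\frac1m\sum_{i=1}^m x_i^k$. The samples and quantization randomness at iteration $k$ are drawn afresh, so the moment conditions below hold conditionally on the past. Expectations are with respect to the randomness in stochastic gradients and quantization generating the iterates involved. Gradient assumption: (1) every $f_i$ is Lipschitz continuous with Lipschitz gradient, $\|\nabla f_i(x)-\nabla f_i(y)\|\le L\|x-y\|$ for all $x,y\in\mathbb{R}^d$,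 and the problem has at least one optimal solution $x^*$, with $\sum_{i=1}^m\nabla f_i(x^* )=0$; (2) for all $i$, $\mathbb{E}_{\xi_i\sim\mathcal{D}_i}[g_i^k]=\nabla f_i(x_i^k)$, and the stochastic gradient at any point $x$ satisfies $\mathbb{E}_{\xi_i\sim\mathcal{D}_i}[\|g_i^k-\nabla f_i(x)\|^2]\le\sigma^2$. Connectivity assumption: the interaction graph is undirected and connected, i.e. the second smallest eigenvalue $\rho$ of the graph Laplacian $L_w=D-W$ is positive, where $W=(w_{ij})$ and $D$ is diagonal with $d_{ii}=\sum_{j\in\mathbb{N}_i}w_{ij}$. Quantizer assumption: there is a constant $\beta$ such that for every $x$, $\mathbb{E}[\mathcal{Q}(x)\mid x]=x$ and $\mathbb{E}[\|\mathcal{Q}(x)-x\|^2\mid x]\le\beta\|x\|^2$; quantizations on different agents are independent of each other. Convexity assumption: every $f_i$ is convex. *)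

theory Defs
  imports "HOL-Probability.Probability"
begin

text \<open>
  Agents are the elements of a finite type \<open>'m\<close>, so the number of agents is \<open>CARD('m)\<close>.
\<close>

definition neighbors :: "real^'m^'m \<Rightarrow> 'm::finite \<Rightarrow> 'm set" where
  "neighbors W i = {j. W $ i $ j > 0}"

definition laplacian :: "real^'m^'m \<Rightarrow> real^'m^('m::finite)" where
  "laplacian W = (\<chi> i j. if i = j then (\<Sum>l\<in>neighbors W i. W $ i $ l) else 0) - W"

definition eigenspace :: "real^'n^'n \<Rightarrow> real \<Rightarrow> (real^'n) set" where
  "eigenspace A c = {v. A *v v = c *\<^sub>R v}"

definition eigenvalues :: "real^'n^'n \<Rightarrow> real set" where
  "eigenvalues A = {c. \<exists>v. v \<noteq> 0 \<and> v \<in> eigenspace A c}"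

text \<open>
  The eigenvalues in increasing order, each repeated according to its geometric multiplicity.
  For a symmetric matrix, the only case of interest, this is also the algebraic multiplicity,
  and the list has length \<open>CARD('n)\<close>.
\<close>

definition eigenvalue_list :: "real^'n^'n \<Rightarrow> real list" where
  "eigenvalue_list A =
     concat (map (\<lambda>c. replicate (dim (eigenspace A c)) c) (sorted_list_of_set (eigenvalues A)))"

definition second_smallest_eigenvalue :: "real^'n^'n \<Rightarrow> real" where
  "second_smallest_eigenvalue A = eigenvalue_list A ! 1"

text \<open>
  The spectral clause is guarded because a single agent has no second eigenvalue; the
  one-vertex graph counts as connected.
\<close>

definition connectivity_assumption :: "real^'m^('m::finite) \<Rightarrow> bool" where
  "connectivity_assumption W \<longleftrightarrow>
     (\<forall>i j. W $ i $ j = W $ j $ i \<and> W $ i $ j \<ge> 0) \<and>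
     (\<forall>i j. (i, j) \<in> {(a, b). b \<in> neighbors W a}\<^sup>*) \<and>
     (CARD('m) \<ge> 2 \<longrightarrow> second_smallest_eigenvalue (laplacian W) > 0)"

definition average :: "('m::finite \<Rightarrow> 'a::real_vector) \<Rightarrow> 'a" where
  "average v = (1 / real CARD('m)) *\<^sub>R (\<Sum>i\<in>UNIV. v i)"

definition gradient :: "('a::real_inner \<Rightarrow> real) \<Rightarrow> 'a \<Rightarrow> 'a" where
  "gradient f x = (THE D. GDERIV f x :> D)"

definition local_objective ::
    "('m \<Rightarrow> 's measure) \<Rightarrow> ('m \<Rightarrow> 'a \<Rightarrow> 's \<Rightarrow> real) \<Rightarrow> 'm \<Rightarrow> 'a \<Rightarrow> real" where
  "local_objective D F i x = (\<integral>s. F i x s \<partial>D i)"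

definition objective ::
    "('m::finite \<Rightarrow> 's measure) \<Rightarrow> ('m \<Rightarrow> 'a \<Rightarrow> 's \<Rightarrow> real) \<Rightarrow> 'a \<Rightarrow> real" where
  "objective D F x = average (\<lambda>i. local_objective D F i x)"

text \<open>
  \<open>G k i x s\<close> is the stochastic gradient of agent \<open>i\<close> at iteration \<open>k\<close>, evaluated at
  the point \<open>x\<close> with the sample \<open>s\<close>. The moment conditions are required at every
  deterministic point \<open>x\<close>; since fresh samples are independent of the past, they then hold at
  the current iterate conditionally on the past.
\<close>

definition gradient_assumption ::
    "('m::finite \<Rightarrow> 's measure) \<Rightarrow> ('m \<Rightarrow> real^'d \<Rightarrow> 's \<Rightarrow> real) \<Rightarrow>
     (nat \<Rightarrow> 'm \<Rightarrow> real^'d \<Rightarrow> 's \<Rightarrow> real^'d) \<Rightarrow> real \<Rightarrow> real \<Rightarrow> real^'d \<Rightarrow> bool" where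
  "gradient_assumption D F G L \<sigma> xopt \<longleftrightarrow>
     (\<forall>i. prob_space (D i)) \<and>
     (\<forall>i x. integrable (D i) (F i x)) \<and>
     (\<forall>i. \<exists>C. C-lipschitz_on UNIV (local_objective D F i)) \<and>
     (\<forall>i x. local_objective D F i differentiable (at x)) \<and>
     (\<forall>i x y. norm (gradient (local_objective D F i) x - gradient (local_objective D F i) y)
               \<le> L * norm (x - y)) \<and>
     (\<forall>x. objective D F xopt \<le> objective D F x) \<and>
     (\<Sum>i\<in>UNIV. gradient (local_objective D F i) xopt) = 0 \<and>
     (\<forall>k i. case_prod (G k i) \<in> borel_measurable (borel \<Otimes>\<^sub>M D i)) \<and>
     (\<forall>k i x. has_bochner_integral (D i) (G k i x) (gradient (local_objective D F i) x)) \<and>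
     (\<forall>k i x. integrable (D i) (\<lambda>s. (norm (G k i x s - gradient (local_objective D F i) x))\<^sup>2) \<and>
               (\<integral>s. (norm (G k i x s - gradient (local_objective D F i) x))\<^sup>2 \<partial>D i) \<le> \<sigma>\<^sup>2)"

text \<open>
  A stochastic quantizer is a random map: \<open>Q x z\<close> is the quantized value of \<open>x\<close> for the
  internal randomness \<open>z\<close>, which has distribution \<open>Z\<close>.
\<close>

definition quantizer_assumption ::
    "'z measure \<Rightarrow> (real^'d \<Rightarrow> 'z \<Rightarrow> real^'d) \<Rightarrow> real \<Rightarrow> bool" where
  "quantizer_assumption Z Q \<beta> \<longleftrightarrow>
     prob_space Z \<and>
     case_prod Q \<in> borel_measurable (borel \<Otimes>\<^sub>M Z) \<and>
     (\<forall>x. has_bochner_integral Z (Q x) x) \<and>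
     (\<forall>x. integrable Z (\<lambda>z. (norm (Q x z - x))\<^sup>2) \<and>
           (\<integral>z. (norm (Q x z - x))\<^sup>2 \<partial>Z) \<le> \<beta> * (norm x)\<^sup>2)"

text \<open>
  \<open>\<xi> k i\<close> and \<open>\<zeta> k i\<close> are the data sample and the quantization randomness of agent \<open>i\<close> at
  iteration \<open>k\<close>. The joint randomness of all agents is independent across iterations, and in
  each iteration the quantizations of different agents are independent. No independence is
  required between the samples of different agents, or between samples and quantizations,
  within one iteration.
\<close>

definition fresh_randomness ::
    "'w measure \<Rightarrow> ('m::finite \<Rightarrow> 's measure) \<Rightarrow> 'z measure \<Rightarrow>
     (nat \<Rightarrow> 'm \<Rightarrow> 'w \<Rightarrow> 's) \<Rightarrow> (nat \<Rightarrow> 'm \<Rightarrow> 'w \<Rightarrow> 'z) \<Rightarrow> bool" where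
  "fresh_randomness M D Z \<xi> \<zeta> \<longleftrightarrow>
     prob_space M \<and>
     (\<forall>k i. \<xi> k i \<in> measurable M (D i) \<and> distr M (D i) (\<xi> k i) = D i) \<and>
     (\<forall>k i. \<zeta> k i \<in> measurable M Z \<and> distr M Z (\<zeta> k i) = Z) \<and>
     prob_space.indep_vars M
       (\<lambda>k. (\<Pi>\<^sub>M i\<in>UNIV. D i) \<Otimes>\<^sub>M (\<Pi>\<^sub>M i\<in>UNIV. Z))
       (\<lambda>k \<omega>. (\<lambda>i. \<xi> k i \<omega>, \<lambda>i. \<zeta> k i \<omega>)) UNIV \<and>
     (\<forall>k. prob_space.indep_vars M (\<lambda>i. Z) (\<zeta> k) UNIV)"

text \<open>
  The single realization \<open>Q (x j \<omega>) (\<zeta> k j \<omega>)\<close> is used by agent \<open>j\<close> and all its neighbors.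
\<close>

primrec iterate ::
    "real^'m^'m \<Rightarrow> (nat \<Rightarrow> real) \<Rightarrow> (nat \<Rightarrow> real) \<Rightarrow>
     (real^'d \<Rightarrow> 'z \<Rightarrow> real^'d) \<Rightarrow> (nat \<Rightarrow> 'm::finite \<Rightarrow> real^'d \<Rightarrow> 's \<Rightarrow> real^'d) \<Rightarrow>
     (nat \<Rightarrow> 'm \<Rightarrow> 'w \<Rightarrow> 's) \<Rightarrow> (nat \<Rightarrow> 'm \<Rightarrow> 'w \<Rightarrow> 'z) \<Rightarrow>
     nat \<Rightarrow> 'm \<Rightarrow> 'w \<Rightarrow> real^'d" where
  "iterate W \<epsilon> lam Q G \<xi> \<zeta> 0 = (\<lambda>i \<omega>. 0)"
| "iterate W \<epsilon> lam Q G \<xi> \<zeta> (Suc k) = (let x = iterate W \<epsilon> lam Q G \<xi> \<zeta> k in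
     (\<lambda>i \<omega>. x i \<omega>
        + \<epsilon> k *\<^sub>R (\<Sum>j\<in>neighbors W i.
            W $ i $ j *\<^sub>R (Q (x j \<omega>) (\<zeta> k j \<omega>) - Q (x i \<omega>) (\<zeta> k i \<omega>)))
        - (\<epsilon> k * lam k) *\<^sub>R G k i (x i \<omega>) (\<xi> k i \<omega>)))"

end

theory Submission
  imports Defs
begin

text \<open>
  Write \<open>V\<^sub>k\<close> for the expected squared distance of all iterates to \<open>x\<^sup>*\<close>. Conditionally on
  the past, the quantized values and the sampled gradients are unbiased with second moments bounded
  by a multiple of \<open>1 + V\<^sub>k\<close> and by a constant, so expanding the square gives a drift made of
  the Dirichlet form of the graph and of the local gradients. A connected graph satisfies a
  Poincare inequality (telescope along paths), so the Dirichlet form dominates the disagreement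
  \<open>\<Sum>\<^sub>i |x\<^sub>i - mean|\<^sup>2\<close>; by convexity and the Lipschitz property the gradient part
  dominates the gap \<open>f(mean) - f(x\<^sup>*)\<close> up to an error absorbed by Young's inequality. Hence
  \<open>V\<^sub>k\<^sub>+\<^sub>1 \<le> (1 + a \<epsilon>\<^sup>2) V\<^sub>k - \<kappa> \<epsilon> disagreement - 2 m \<epsilon> \<lambda> gap + b (\<epsilon>\<^sup>2 + \<epsilon> \<lambda>\<^sup>2 + \<epsilon>\<^sup>2 \<lambda>\<^sup>2)\<close>,
  and the deterministic Robbins-Siegmund lemma makes \<open>\<Sum> \<epsilon> disagreement\<close> and
  \<open>\<Sum> \<epsilon> \<lambda> gap\<close> finite. By AM-GM also \<open>\<Sum> \<epsilon> \<lambda> E|x\<^sub>i - mean|\<close> is finite, and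
  each quantity in the theorem is bounded by an \<open>\<epsilon> \<lambda>\<close>-weighted average of a combination of
  these, the last one through Jensen's inequality.
\<close>

subsection \<open>Gradients of convex functions\<close>

text \<open>Riesz representation in coordinates: the gradient has the values of the derivative on
  the standard basis as coefficients. Uniqueness of the derivative then justifies the definite
  description in \<open>gradient\<close>.\<close>

lemma GDERIV_gradient:
  fixes f :: "'a::euclidean_space \<Rightarrow> real"
  assumes "f differentiable (at x)"
  shows "GDERIV f x :> gradient f x"
proof -
  obtain f' where f': "(f has_derivative f') (at x)"
    using assms by (auto simp: differentiable_def)
  have lin: "linear f'"
    using f' by (rule has_derivative_linear)
  have "f' = (\<lambda>h. h \<bullet> (\<Sum>b\<in>Basis. f' b *\<^sub>R b))"
  proof
    fix h
    have "f' h = f' (\<Sum>b\<in>Basis. (h \<bullet> b) *\<^sub>R b)"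
      by (simp add: euclidean_representation)
    also have "\<dots> = (\<Sum>b\<in>Basis. (h \<bullet> b) * f' b)"
      by (simp add: linear_sum[OF lin] linear_cmul[OF lin])
    also have "\<dots> = h \<bullet> (\<Sum>b\<in>Basis. f' b *\<^sub>R b)"
      by (simp add: inner_sum_right mult.commute)
    finally show "f' h = h \<bullet> (\<Sum>b\<in>Basis. f' b *\<^sub>R b)" .
  qed
  then have ex: "GDERIV f x :> (\<Sum>b\<in>Basis. f' b *\<^sub>R b)"
    using f' unfolding gderiv_def by simp
  show ?thesis
    unfolding gradient_def
  proof (rule theI[where P="\<lambda>D. GDERIV f x :> D", OF ex])
    fix D assume "GDERIV f x :> D"
    with ex have "(\<lambda>h. h \<bullet> D) = (\<lambda>h. h \<bullet> (\<Sum>b\<in>Basis. f' b *\<^sub>R b))"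
      unfolding gderiv_def by (rule has_derivative_unique[rotated])
    then show "D = (\<Sum>b\<in>Basis. f' b *\<^sub>R b)"
      by (metis vector_eq_ldot)
  qed
qed

lemma gradient_eqI:
  fixes f :: "'a::euclidean_space \<Rightarrow> real"
  assumes "GDERIV f x :> D"
  shows "gradient f x = D"
proof -
  have "GDERIV f x :> gradient f x"
    using assms by (intro GDERIV_gradient) (auto simp: gderiv_def differentiable_def)
  with assms have "(\<lambda>h. h \<bullet> D) = (\<lambda>h. h \<bullet> gradient f x)"
    unfolding gderiv_def by (rule has_derivative_unique)
  then show ?thesis
    by (metis vector_eq_ldot)
qed

lemma GDERIV_average:
  assumes "\<And>i. GDERIV (f i) x :> D i"
  shows "GDERIV (\<lambda>x. average (\<lambda>i. f i x)) x :> average D"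
  unfolding gderiv_def average_def
  by (rule has_derivative_eq_rhs, (rule derivative_intros assms[unfolded gderiv_def])+)
     (simp add: inner_sum_right)

text \<open>Restricting \<open>f\<close> to the line through \<open>x\<close> and \<open>y\<close>
  gives a convex function of one real variable, whose tangent at 0 lies below its value at
  1.\<close>

lemma convex_gradient_le:
  fixes f :: "'a::euclidean_space \<Rightarrow> real"
  assumes conv: "convex_on UNIV f" and diff: "f differentiable (at x)"
  shows "f x + gradient f x \<bullet> (y - x) \<le> f y"
proof -
  have der: "(f has_derivative (\<lambda>h. h \<bullet> gradient f x)) (at x)"
    using GDERIV_gradient[OF diff] by (simp add: gderiv_def)
  define g where "g = (\<lambda>t. f (x + t *\<^sub>R (y - x)))"
  have "(g has_derivative (\<lambda>t. (t *\<^sub>R (y - x)) \<bullet> gradient f x)) (at 0)"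
    unfolding g_def
    by (rule has_derivative_compose[where g=f and g'="\<lambda>h. h \<bullet> gradient f x"])
       (auto intro!: derivative_eq_intros der)
  then have dg: "(g has_real_derivative ((y - x) \<bullet> gradient f x)) (at 0)"
    unfolding has_field_derivative_def by (simp add: mult_commute_abs)
  have "convex_on UNIV g"
  proof (rule convex_onI)
    fix t a b :: real assume t: "0 < t" "t < 1"
    have "x + ((1 - t) *\<^sub>R a + t *\<^sub>R b) *\<^sub>R (y - x)
        = (1 - t) *\<^sub>R (x + a *\<^sub>R (y - x)) + t *\<^sub>R (x + b *\<^sub>R (y - x))"
      by (simp add: algebra_simps)
    then show "g ((1 - t) *\<^sub>R a + t *\<^sub>R b) \<le> (1 - t) * g a + t * g b"
      using convex_onD[OF conv, of t "x + a *\<^sub>R (y - x)" "x + b *\<^sub>R (y - x)"] t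
      by (simp add: g_def)
  qed simp
  then have "g 1 - g 0 \<ge> (y - x) \<bullet> gradient f x * (1 - 0)"
    by (rule convex_on_imp_above_tangent) (use dg in auto)
  then show ?thesis
    by (simp add: g_def inner_commute)
qed

text \<open>Comparing the tangent inequality with the Lipschitz bound at the point \<open>x\<close>
  plus its own gradient yields \<open>norm ?g * norm ?g \<le> C * norm ?g\<close>.\<close>

lemma norm_gradient_le_lipschitz:
  fixes f :: "'a::euclidean_space \<Rightarrow> real"
  assumes "convex_on UNIV f" "f differentiable (at x)" "C-lipschitz_on UNIV f"
  shows "norm (gradient f x) \<le> C"
proof -
  let ?g = "gradient f x"
  have "(norm ?g)\<^sup>2 \<le> f (x + ?g) - f x"
    using convex_gradient_le[OF assms(1,2), of "x + ?g"] by (simp add: power2_norm_eq_inner)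
  also have "\<dots> \<le> C * norm ?g"
    using lipschitz_onD[OF assms(3), of "x + ?g" x] by (simp add: dist_norm)
  finally have "norm ?g * norm ?g \<le> C * norm ?g"
    by (simp add: power2_eq_square)
  then show ?thesis
    using lipschitz_on_nonneg[OF assms(3)] by (cases "?g = 0") auto
qed

text \<open>One gradient step from \<open>x\<close> cannot go below \<open>c\<close>. The decrease
  is read off the tangent at the new point \<open>y\<close>, with the Lipschitz property comparing
  the two gradients; this gives the constant 4, where integrating along the segment would give
  2.\<close>

lemma norm_gradient_sq_le:
  fixes f :: "'a::euclidean_space \<Rightarrow> real"
  assumes conv: "convex_on UNIV f" and diff: "\<And>x. f differentiable (at x)"
    and lip: "\<And>x y. norm (gradient f x - gradient f y) \<le> L * norm (x - y)"
    and L: "L > 0" and min: "\<And>x. c \<le> f x"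
  shows "(norm (gradient f x))\<^sup>2 \<le> 4 * L * (f x - c)"
proof -
  let ?g = "gradient f x"
  \<comment> \<open>A step of length t earns t - L t^2 times the squared gradient norm;
    \<open>1 / (2 * L)\<close> maximises this.\<close>
  define y where "y = x - (1 / (2 * L)) *\<^sub>R ?g"
  have "gradient f y \<bullet> (x - y) \<ge> ?g \<bullet> (x - y) - norm (?g - gradient f y) * norm (x - y)"
    using norm_cauchy_schwarz[of "?g - gradient f y" "x - y"] by (simp add: inner_diff_left)
  moreover have "norm (?g - gradient f y) * norm (x - y) \<le> L * norm (x - y) * norm (x - y)"
    by (intro mult_right_mono lip) simp
  moreover have "f y + gradient f y \<bullet> (x - y) \<le> f x"
    by (rule convex_gradient_le[OF conv diff])
  moreover have "c \<le> f y" by (rule min)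
  moreover have "?g \<bullet> (x - y) = (norm ?g)\<^sup>2 / (2 * L)"
    by (simp add: y_def power2_norm_eq_inner)
  moreover have "L * norm (x - y) * norm (x - y) = (norm ?g)\<^sup>2 / (4 * L)"
  proof -
    have "norm (x - y) = norm ?g / (2 * L)"
      using L by (simp add: y_def)
    then show ?thesis
      using L by (simp add: power2_eq_square)
  qed
  ultimately have "(norm ?g)\<^sup>2 / (2 * L) - (norm ?g)\<^sup>2 / (4 * L) \<le> f x - c"
    by linarith
  then show ?thesis
    using L by (simp add: field_simps)
qed

subsection \<open>The Robbins-Siegmund lemma\<close>

text \<open>Dividing by the partial products \<open>P\<close> of the growth factors turns the
  recursion into one that telescopes. Since \<open>a\<close> is summable, \<open>P\<close> stays
  between 1 and \<open>exp (suminf a)\<close>, so the normalisation changes \<open>u\<close> only by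
  bounded factors.\<close>

lemma summable_Robbins_Siegmund:
  fixes V a b u :: "nat \<Rightarrow> real"
  assumes step: "\<And>k. V (Suc k) \<le> (1 + a k) * V k - u k + b k"
    and nonneg: "\<And>k. 0 \<le> V k" "\<And>k. 0 \<le> a k" "\<And>k. 0 \<le> b k" "\<And>k. 0 \<le> u k"
    and a: "summable a" and b: "summable b"
  shows "summable u"
proof -
  define P where "P = (\<lambda>k. \<Prod>l<k. 1 + a l)"
  have P1: "1 \<le> P k" for k
    unfolding P_def by (intro prod_ge_1) (simp add: nonneg)
  have P_le: "P k \<le> exp (suminf a)" for k
  proof -
    have "P k \<le> (\<Prod>l<k. exp (a l))"
      unfolding P_def by (intro prod_mono) (use nonneg in \<open>auto simp: add_nonneg_nonneg exp_ge_add_one_self\<close>)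
    also have "\<dots> = exp (\<Sum>l<k. a l)"
      by (simp add: exp_sum)
    also have "\<dots> \<le> exp (suminf a)"
      using sum_le_suminf[OF a] nonneg by simp
    finally show ?thesis .
  qed
  \<comment> \<open>The divisor of \<open>u k\<close> is \<open>P (Suc k)\<close> because the step
    from \<open>k\<close> to \<open>Suc k\<close> is normalised by the later product, which cancels
    the factor \<open>1 + a k\<close>.\<close>
  have bound: "V n / P n + (\<Sum>k<n. u k / P (Suc k)) \<le> V 0 + (\<Sum>k<n. b k)" for n
  proof (induction n)
    case (Suc n)
    have "V (Suc n) / P (Suc n) \<le> ((1 + a n) * V n - u n + b n) / P (Suc n)"
      using P1[of "Suc n"] by (intro divide_right_mono step) simp
    also have "\<dots> = (1 + a n) * V n / P (Suc n) - u n / P (Suc n) + b n / P (Suc n)"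
      by (simp add: add_divide_distrib diff_divide_distrib)
    also have "(1 + a n) * V n / P (Suc n) = V n / P n"
      using nonneg(2)[of n] by (simp add: P_def)
    also have "b n / P (Suc n) \<le> b n"
      using P1[of "Suc n"] nonneg(3)[of n] by (simp add: divide_le_eq mult_le_cancel_left1)
    finally show ?case
      using Suc by simp
  qed (simp add: P_def)
  show ?thesis
  proof (rule summableI_nonneg_bounded)
    fix n
    \<comment> \<open>The normalisation is undone with the upper bound on \<open>P\<close>.\<close>
    have "(\<Sum>k<n. u k) \<le> (\<Sum>k<n. exp (suminf a) * (u k / P (Suc k)))"
    proof (rule sum_mono)
      fix k
      have "u k * P (Suc k) \<le> u k * exp (suminf a)"
        by (intro mult_left_mono P_le nonneg)
      then show "u k \<le> exp (suminf a) * (u k / P (Suc k))"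
        using P1[of "Suc k"] by (simp add: field_simps)
    qed
    also have "\<dots> = exp (suminf a) * (\<Sum>k<n. u k / P (Suc k))"
      by (simp add: sum_distrib_left)
    also have "\<dots> \<le> exp (suminf a) * (V 0 + suminf b)"
    proof (intro mult_left_mono)
      have "0 \<le> V n / P n"
        using nonneg(1)[of n] P1[of n] by simp
      moreover have "(\<Sum>k<n. b k) \<le> suminf b"
        using sum_le_suminf[OF b] nonneg by simp
      ultimately show "(\<Sum>k<n. u k / P (Suc k)) \<le> V 0 + suminf b"
        using bound[of n] by linarith
    qed simp
    finally show "(\<Sum>k<n. u k) \<le> exp (suminf a) * (V 0 + suminf b)" .
  qed (rule nonneg)
qed

subsection \<open>Dirichlet form of a connected graph\<close>

lemma norm_diff_sq_le_two:
  "(norm (a - c))\<^sup>2 \<le> 2 * (norm (a - b))\<^sup>2 + 2 * (norm (b - c))\<^sup>2"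
  for a b c :: "'a::real_inner"
proof -
  have "norm (a - c) \<le> norm (a - b) + norm (b - c)"
    using norm_triangle_ineq[of "a - b" "b - c"] by simp
  then have "(norm (a - c))\<^sup>2 \<le> (norm (a - b) + norm (b - c))\<^sup>2"
    by (rule power_mono) simp
  also have "\<dots> \<le> 2 * (norm (a - b))\<^sup>2 + 2 * (norm (b - c))\<^sup>2"
    using sum_squares_bound[of "norm (a - b)" "norm (b - c)"] by (simp add: power2_sum)
  finally show ?thesis .
qed

text \<open>The sum runs over ordered pairs, so for symmetric nonnegative weights it is twice the
  quadratic form of \<open>laplacian W\<close>, summed over the coordinates of
  \<open>v\<close>.\<close>

definition dirichlet :: "real^'m^'m \<Rightarrow> ('m::finite \<Rightarrow> 'a::real_inner) \<Rightarrow> real" where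
  "dirichlet W v = (\<Sum>i\<in>UNIV. \<Sum>j\<in>UNIV. W $ i $ j * (norm (v i - v j))\<^sup>2)"

lemma dirichlet_nonneg: "(\<And>i j. W $ i $ j \<ge> 0) \<Longrightarrow> 0 \<le> dirichlet W v"
  unfolding dirichlet_def by (intro sum_nonneg mult_nonneg_nonneg) auto

lemma edge_le_dirichlet:
  assumes "\<And>i j. W $ i $ j \<ge> 0"
  shows "W $ i $ j * (norm (v i - v j))\<^sup>2 \<le> dirichlet W v"
proof -
  have "W $ i $ j * (norm (v i - v j))\<^sup>2 \<le> (\<Sum>j\<in>UNIV. W $ i $ j * (norm (v i - v j))\<^sup>2)"
    by (rule member_le_sum) (use assms in auto)
  also have "\<dots> \<le> dirichlet W v"
    unfolding dirichlet_def
    by (rule member_le_sum[where f="\<lambda>i. \<Sum>j\<in>UNIV. W $ i $ j * (norm (v i - v j))\<^sup>2"])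
       (use assms in \<open>auto intro!: sum_nonneg\<close>)
  finally show ?thesis .
qed

text \<open>Induction along the path: appending an edge of weight w replaces \<open>K\<close> by 2 K
  + 2 / w. The constant depends on the path alone and is chosen before \<open>v\<close>, as the
  Poincare inequality requires.\<close>

lemma path_le_dirichlet:
  fixes W :: "real^'m^('m::finite)"
  assumes nonneg: "\<And>i j. W $ i $ j \<ge> 0" and path: "(i, j) \<in> {(a, b). b \<in> neighbors W a}\<^sup>*"
  shows "\<exists>K\<ge>0. \<forall>v :: 'm \<Rightarrow> 'a::real_inner. (norm (v i - v j))\<^sup>2 \<le> K * dirichlet W v"
  using path
proof (induction rule: rtrancl_induct)
  case (step b c)
  then obtain K where K: "K \<ge> 0" "\<And>v :: 'm \<Rightarrow> 'a. (norm (v i - v b))\<^sup>2 \<le> K * dirichlet W v"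
    by blast
  have w: "W $ b $ c > 0"
    using step by (simp add: neighbors_def)
  have "(norm (v i - v c))\<^sup>2 \<le> (2 * K + 2 / W $ b $ c) * dirichlet W v" for v :: "'m \<Rightarrow> 'a"
  proof -
    have "(norm (v b - v c))\<^sup>2 \<le> dirichlet W v / W $ b $ c"
      using edge_le_dirichlet[of W b c v, OF nonneg] w by (simp add: field_simps)
    then have "(norm (v i - v c))\<^sup>2 \<le> 2 * (K * dirichlet W v) + 2 * (dirichlet W v / W $ b $ c)"
      using norm_diff_sq_le_two[of "v i" "v c" "v b"] K(2)[of v] by linarith
    then show ?thesis
      by (simp add: algebra_simps)
  qed
  then show ?case
    using K(1) w by (intro exI[of _ "2 * K + 2 / W $ b $ c"]) auto
qed (auto intro!: exI[of _ 0])

text \<open>Cauchy-Schwarz even gives the mean of the squares on the right; the factor 1 / m is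
  dropped.\<close>

lemma norm_average_sq_le:
  "(norm (average v))\<^sup>2 \<le> (\<Sum>i\<in>UNIV. (norm (v i))\<^sup>2)"
  for v :: "'m::finite \<Rightarrow> 'a::real_inner"
proof -
  have m: "real CARD('m) \<ge> 1"
    by (simp add: Suc_leI)
  have "(norm (average v))\<^sup>2 = (norm (\<Sum>i\<in>UNIV. v i))\<^sup>2 / (real CARD('m))\<^sup>2"
    by (simp add: average_def power_divide)
  also have "\<dots> \<le> (\<Sum>i\<in>UNIV. norm (v i))\<^sup>2 / (real CARD('m))\<^sup>2"
    by (intro divide_right_mono power_mono norm_sum) auto
  also have "\<dots> \<le> (\<Sum>i\<in>UNIV. (norm (v i))\<^sup>2) * CARD('m) / (real CARD('m))\<^sup>2"
    by (intro divide_right_mono sum_squared_le_sum_of_squares) auto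
  also have "\<dots> = (\<Sum>i\<in>UNIV. (norm (v i))\<^sup>2) / CARD('m)"
    by (simp add: power2_eq_square)
  also have "\<dots> \<le> (\<Sum>i\<in>UNIV. (norm (v i))\<^sup>2) / 1"
    using m by (intro divide_left_mono sum_nonneg) auto
  finally show ?thesis by simp
qed

lemma diff_average: "a - average v = average (\<lambda>j. a - v j)"
  for v :: "'m::finite \<Rightarrow> 'a::real_vector"
  by (simp add: average_def sum_subtractf scaleR_diff_right sum_constant_scaleR)

text \<open>The deviation of \<open>v i\<close> from the mean is the average of the differences
  \<open>v i - v j\<close>, and each of these is controlled along a path from \<open>i\<close> to
  \<open>j\<close>.\<close>

lemma connected_imp_poincare:
  fixes W :: "real^'m^('m::finite)"
  assumes nonneg: "\<And>i j. W $ i $ j \<ge> 0"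
    and path: "\<And>i j. (i, j) \<in> {(a, b). b \<in> neighbors W a}\<^sup>*"
  obtains \<kappa> where "\<kappa> > 0"
    "\<And>v :: 'm \<Rightarrow> 'a::real_inner. \<kappa> * (\<Sum>i\<in>UNIV. (norm (v i - average v))\<^sup>2) \<le> dirichlet W v"
proof -
  obtain K where K: "\<And>i j. K i j \<ge> 0"
    "\<And>i j. \<And>v :: 'm \<Rightarrow> 'a. (norm (v i - v j))\<^sup>2 \<le> K i j * dirichlet W v"
    using path_le_dirichlet[OF nonneg path] by metis
  define S where "S = (\<Sum>i\<in>UNIV. \<Sum>j\<in>UNIV. K i j)"
  have "S \<ge> 0"
    unfolding S_def by (intro sum_nonneg K)
  have le: "(\<Sum>i\<in>UNIV. (norm (v i - average v))\<^sup>2) \<le> S * dirichlet W v" for v :: "'m \<Rightarrow> 'a"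
  proof -
    have "(\<Sum>i\<in>UNIV. (norm (v i - average v))\<^sup>2)
        \<le> (\<Sum>i\<in>UNIV. \<Sum>j\<in>UNIV. (norm (v i - v j))\<^sup>2)"
      unfolding diff_average by (intro sum_mono norm_average_sq_le)
    also have "\<dots> \<le> (\<Sum>i\<in>UNIV. \<Sum>j\<in>UNIV. K i j * dirichlet W v)"
      by (intro sum_mono K)
    finally show ?thesis
      by (simp add: S_def sum_distrib_right)
  qed
  show ?thesis
  \<comment> \<open>The sum \<open>S\<close> may vanish, for instance with a single agent; adding 1
    keeps the quotient positive.\<close>
  proof (rule that[of "1 / (S + 1)"])
    fix v :: "'m \<Rightarrow> 'a"
    have "S * dirichlet W v \<le> (S + 1) * dirichlet W v"
      using dirichlet_nonneg[OF nonneg] by (intro mult_right_mono) auto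
    then show "1 / (S + 1) * (\<Sum>i\<in>UNIV. (norm (v i - average v))\<^sup>2) \<le> dirichlet W v"
      using le[of v] \<open>S \<ge> 0\<close> by (simp add: field_simps)
  qed (use \<open>S \<ge> 0\<close> in auto)
qed

text \<open>Swapping \<open>i\<close> and \<open>j\<close> and adding the two copies cancels the
  reference point \<open>c\<close>. Hence the cross term of the expanded square is a Dirichlet form
  even though it is centred at the optimum.\<close>

lemma sum_symmetric_weights:
  fixes v :: "'m::finite \<Rightarrow> 'a::real_inner"
  assumes sym: "\<And>i j. W $ i $ j = W $ j $ i"
  shows "2 * (\<Sum>i\<in>UNIV. \<Sum>j\<in>UNIV. W $ i $ j * ((v i - c) \<bullet> (v i - v j))) = dirichlet W v"
proof -
  let ?S = "\<Sum>i\<in>UNIV. \<Sum>j\<in>UNIV. W $ i $ j * ((v i - c) \<bullet> (v i - v j))"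
  have "?S = (\<Sum>j\<in>UNIV. \<Sum>i\<in>UNIV. W $ i $ j * ((v i - c) \<bullet> (v i - v j)))"
    by (rule sum.swap)
  also have "\<dots> = (\<Sum>i\<in>UNIV. \<Sum>j\<in>UNIV. W $ i $ j * ((v j - c) \<bullet> (v j - v i)))"
    by (intro sum.cong refl) (metis sym)
  finally have "2 * ?S = (\<Sum>i\<in>UNIV. \<Sum>j\<in>UNIV. W $ i $ j * ((v i - c) \<bullet> (v i - v j)))
      + (\<Sum>i\<in>UNIV. \<Sum>j\<in>UNIV. W $ i $ j * ((v j - c) \<bullet> (v j - v i)))" by simp
  also have "\<dots> = dirichlet W v"
    unfolding dirichlet_def sum.distrib[symmetric]
    by (intro sum.cong refl) (simp add: power2_norm_eq_inner algebra_simps inner_commute)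
  finally show ?thesis .
qed

subsection \<open>Square-integrable random variables and fresh randomness\<close>

text \<open>Measurability of \<open>f\<close> is a separate conjunct because integrability of the
  squared norm does not imply it.\<close>

definition L2 :: "'w measure \<Rightarrow> ('w \<Rightarrow> 'a::euclidean_space) \<Rightarrow> bool" where
  "L2 M f \<longleftrightarrow> f \<in> borel_measurable M \<and> integrable M (\<lambda>\<omega>. (norm (f \<omega>))\<^sup>2)"

lemma L2_measurable [measurable_dest]: "L2 M f \<Longrightarrow> f \<in> borel_measurable M"
  by (simp add: L2_def)

lemma L2_integrable_sq: "L2 M f \<Longrightarrow> integrable M (\<lambda>\<omega>. (norm (f \<omega>))\<^sup>2)"
  by (simp add: L2_def)

lemma norm_add_sq_le: "(norm (a + b))\<^sup>2 \<le> 2 * (norm a)\<^sup>2 + 2 * (norm b)\<^sup>2"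
  for a b :: "'a::real_inner"
  using norm_diff_sq_le_two[of a "- b" 0] by simp

lemma L2_bound:
  assumes g: "integrable M g" and f: "f \<in> borel_measurable M"
    and le: "\<And>\<omega>. (norm (f \<omega>))\<^sup>2 \<le> g \<omega>"
  shows "L2 M f"
proof -
  have "integrable M (\<lambda>\<omega>. (norm (f \<omega>))\<^sup>2)"
    by (rule Bochner_Integration.integrable_bound[OF g]) (use f le order_trans[OF le abs_ge_self] in auto)
  with f show ?thesis by (simp add: L2_def)
qed

lemma L2_add:
  assumes f: "L2 M f" and g: "L2 M g"
  shows "L2 M (\<lambda>\<omega>. f \<omega> + g \<omega>)"
  by (rule L2_bound[where g="\<lambda>\<omega>. 2 * (norm (f \<omega>))\<^sup>2 + 2 * (norm (g \<omega>))\<^sup>2"])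
     (use f g norm_add_sq_le in \<open>auto simp: L2_def intro!: integrable_add integrable_mult_right\<close>)

lemma L2_scaleR: "L2 M f \<Longrightarrow> L2 M (\<lambda>\<omega>. c *\<^sub>R f \<omega>)"
  by (auto simp: L2_def power_mult_distrib)

lemma L2_diff:
  assumes f: "L2 M f" and g: "L2 M g"
  shows "L2 M (\<lambda>\<omega>. f \<omega> - g \<omega>)"
  using L2_add[OF f L2_scaleR[OF g, of "-1"]] by simp

lemma (in finite_measure) L2_const: "L2 M (\<lambda>\<omega>. c)"
  by (simp add: L2_def)

lemma (in finite_measure) L2_sum:
  "(\<And>i. i \<in> I \<Longrightarrow> L2 M (f i)) \<Longrightarrow> L2 M (\<lambda>\<omega>. \<Sum>i\<in>I. f i \<omega>)"
  by (induction I rule: infinite_finite_induct) (auto intro: L2_add L2_const)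

lemma (in finite_measure) L2_average:
  fixes f :: "'m::finite \<Rightarrow> 'a \<Rightarrow> 'b::euclidean_space"
  shows "(\<And>i. L2 M (f i)) \<Longrightarrow> L2 M (\<lambda>\<omega>. average (\<lambda>i. f i \<omega>))"
  unfolding average_def by (intro L2_scaleR L2_sum)

lemma L2_integrable_inner:
  assumes f: "L2 M f" and g: "L2 M g"
  shows "integrable M (\<lambda>\<omega>. f \<omega> \<bullet> g \<omega>)"
proof (rule Bochner_Integration.integrable_bound)
  show "integrable M (\<lambda>\<omega>. (norm (f \<omega>))\<^sup>2 + (norm (g \<omega>))\<^sup>2)"
    using f g by (auto intro: L2_integrable_sq)
  have "\<bar>f \<omega> \<bullet> g \<omega>\<bar> \<le> (norm (f \<omega>))\<^sup>2 + (norm (g \<omega>))\<^sup>2" for \<omega>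
    using Cauchy_Schwarz_ineq2[of "f \<omega>" "g \<omega>"] sum_squares_bound[of "norm (f \<omega>)" "norm (g \<omega>)"]
      mult_nonneg_nonneg[OF norm_ge_zero[of "f \<omega>"] norm_ge_zero[of "g \<omega>"]]
    by linarith
  then show "AE \<omega> in M. norm (f \<omega> \<bullet> g \<omega>) \<le> norm ((norm (f \<omega>))\<^sup>2 + (norm (g \<omega>))\<^sup>2)"
    by simp
qed (use f g in measurable)

lemma (in finite_measure) L2_integrable:
  assumes "L2 M f"
  shows "integrable M f"
  using assms
  by (intro integrable_norm_cancel[OF square_integrable_imp_integrable[of "\<lambda>\<omega>. norm (f \<omega>)"]])
     (auto simp: L2_def)

context prob_space
begin

text \<open>Conditioning on the state without conditional expectations: the joint law of state
  \<open>X\<close> and fresh noise \<open>R\<close> is a product with second factor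
  \<open>N\<close>, so the noise is integrated out first at a frozen state, where the bound
  \<open>b\<close> applies.\<close>

lemma fresh_second_moment:
  fixes \<phi> :: "'b \<Rightarrow> 'c \<Rightarrow> 'e::euclidean_space"
  assumes N: "prob_space N"
    and X [measurable]: "X \<in> measurable M S" and R [measurable]: "R \<in> measurable M N"
    and joint: "distr M (S \<Otimes>\<^sub>M N) (\<lambda>\<omega>. (X \<omega>, R \<omega>)) = distr M S X \<Otimes>\<^sub>M N"
    and \<phi>: "case_prod \<phi> \<in> borel_measurable (S \<Otimes>\<^sub>M N)"
    and bound: "\<And>x. integrable N (\<lambda>r. (norm (\<phi> x r))\<^sup>2)"
      "\<And>x. (\<integral>r. (norm (\<phi> x r))\<^sup>2 \<partial>N) \<le> b x"
    and b: "b \<in> borel_measurable S" "integrable M (\<lambda>\<omega>. b (X \<omega>))"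
  shows "L2 M (\<lambda>\<omega>. \<phi> (X \<omega>) (R \<omega>))"
    and "(\<integral>\<omega>. (norm (\<phi> (X \<omega>) (R \<omega>)))\<^sup>2 \<partial>M) \<le> (\<integral>\<omega>. b (X \<omega>) \<partial>M)"
proof -
  note \<phi> [measurable] b(1) [measurable]
  interpret N: prob_space N
    by (rule N)
  have b_nonneg: "0 \<le> b x" for x
    using bound(2)[of x] by (rule order_trans[rotated]) simp
  \<comment> \<open>Nonnegative integrals come first: integrability is part of the claim, and
    Tonelli does not presuppose it.\<close>
  have "(\<integral>\<^sup>+\<omega>. ennreal ((norm (\<phi> (X \<omega>) (R \<omega>)))\<^sup>2) \<partial>M)
      = (\<integral>\<^sup>+p. ennreal ((norm (case_prod \<phi> p))\<^sup>2) \<partial>(distr M (S \<Otimes>\<^sub>M N) (\<lambda>\<omega>. (X \<omega>, R \<omega>))))"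
    by (subst nn_integral_distr) auto
  also have "\<dots> = (\<integral>\<^sup>+x. \<integral>\<^sup>+r. ennreal ((norm (\<phi> x r))\<^sup>2) \<partial>N \<partial>distr M S X)"
    unfolding joint by (subst N.nn_integral_fst[symmetric]) (auto simp: measurable_split_conv)
  also have "\<dots> \<le> (\<integral>\<^sup>+x. ennreal (b x) \<partial>distr M S X)"
    using bound by (intro nn_integral_mono) (simp add: nn_integral_eq_integral ennreal_leI)
  also have "\<dots> = (\<integral>\<^sup>+\<omega>. ennreal (b (X \<omega>)) \<partial>M)"
    by (subst nn_integral_distr) auto
  also have "\<dots> = ennreal (\<integral>\<omega>. b (X \<omega>) \<partial>M)"
    using b b_nonneg by (intro nn_integral_eq_integral) auto
  finally have le: "(\<integral>\<^sup>+\<omega>. ennreal ((norm (\<phi> (X \<omega>) (R \<omega>)))\<^sup>2) \<partial>M) \<le> ennreal (\<integral>\<omega>. b (X \<omega>) \<partial>M)" .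
  have meas [measurable]: "(\<lambda>\<omega>. \<phi> (X \<omega>) (R \<omega>)) \<in> borel_measurable M"
    using measurable_compose[OF measurable_Pair[OF X R] \<phi>] by simp
  have int: "integrable M (\<lambda>\<omega>. (norm (\<phi> (X \<omega>) (R \<omega>)))\<^sup>2)"
    using le by (intro integrableI_bounded) (auto simp: top.not_eq_extremum[symmetric] top_unique)
  with meas show "L2 M (\<lambda>\<omega>. \<phi> (X \<omega>) (R \<omega>))"
    by (simp add: L2_def)
  show "(\<integral>\<omega>. (norm (\<phi> (X \<omega>) (R \<omega>)))\<^sup>2 \<partial>M) \<le> (\<integral>\<omega>. b (X \<omega>) \<partial>M)"
    using le int b_nonneg by (subst (asm) nn_integral_eq_integral) (auto simp: integral_nonneg_AE)
qed

text \<open>The tower property: against a test vector \<open>u\<close> depending on the state alone,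
  the noisy value may be replaced by its conditional mean \<open>\<psi>\<close>. Square
  integrability of both factors makes Fubini applicable.\<close>

lemma fresh_mean:
  fixes \<phi> :: "'b \<Rightarrow> 'c \<Rightarrow> 'e::euclidean_space"
  assumes N: "prob_space N"
    and X [measurable]: "X \<in> measurable M S" and R [measurable]: "R \<in> measurable M N"
    and joint: "distr M (S \<Otimes>\<^sub>M N) (\<lambda>\<omega>. (X \<omega>, R \<omega>)) = distr M S X \<Otimes>\<^sub>M N"
    and \<phi>: "case_prod \<phi> \<in> borel_measurable (S \<Otimes>\<^sub>M N)"
    and mean: "\<And>x. has_bochner_integral N (\<phi> x) (\<psi> x)"
    and \<psi>: "\<psi> \<in> borel_measurable S" and u: "u \<in> borel_measurable S"
    and L2: "L2 M (\<lambda>\<omega>. u (X \<omega>))" "L2 M (\<lambda>\<omega>. \<phi> (X \<omega>) (R \<omega>))"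
  shows "(\<integral>\<omega>. u (X \<omega>) \<bullet> \<phi> (X \<omega>) (R \<omega>) \<partial>M) = (\<integral>\<omega>. u (X \<omega>) \<bullet> \<psi> (X \<omega>) \<partial>M)"
proof -
  note \<phi> [measurable] \<psi> [measurable] u [measurable]
  interpret N: prob_space N
    by (rule N)
  interpret X: prob_space "distr M S X"
    by (rule prob_space_distr[OF X])
  interpret pair_sigma_finite "distr M S X" N ..
  define h where "h = (\<lambda>p. u (fst p) \<bullet> case_prod \<phi> p)"
  have h [measurable]: "h \<in> borel_measurable (S \<Otimes>\<^sub>M N)"
    unfolding h_def by measurable
  have "integrable (distr M (S \<Otimes>\<^sub>M N) (\<lambda>\<omega>. (X \<omega>, R \<omega>))) h"
    using L2_integrable_inner[OF L2] by (subst integrable_distr_eq) (auto simp: h_def)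
  then have int: "integrable (distr M S X \<Otimes>\<^sub>M N) h"
    by (simp add: joint)
  have "(\<integral>\<omega>. u (X \<omega>) \<bullet> \<phi> (X \<omega>) (R \<omega>) \<partial>M)
      = integral\<^sup>L (distr M (S \<Otimes>\<^sub>M N) (\<lambda>\<omega>. (X \<omega>, R \<omega>))) h"
    by (subst integral_distr) (auto simp: h_def)
  also have "\<dots> = (\<integral>x. \<integral>r. h (x, r) \<partial>N \<partial>distr M S X)"
    unfolding joint by (rule integral_fst'[OF int, symmetric])
  also have "\<dots> = (\<integral>x. u x \<bullet> \<psi> x \<partial>distr M S X)"
  proof -
    have "(\<integral>r. h (x, r) \<partial>N) = u x \<bullet> \<psi> x" for x
      using mean[of x] by (simp add: h_def has_bochner_integral_iff)
    then show ?thesis by simp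
  qed
  also have "\<dots> = (\<integral>\<omega>. u (X \<omega>) \<bullet> \<psi> (X \<omega>) \<partial>M)"
    by (subst integral_distr) auto
  finally show ?thesis .
qed

end

subsection \<open>Independence of the iterates from fresh randomness\<close>

text \<open>The two runs may live on different sample spaces. This permits replaying the recursion
  on the space of past randomness.\<close>

lemma iterate_cong:
  assumes "\<And>l i. l < k \<Longrightarrow> \<xi> l i \<omega> = \<xi>' l i \<omega>'" "\<And>l i. l < k \<Longrightarrow> \<zeta> l i \<omega> = \<zeta>' l i \<omega>'"
  shows "iterate W \<epsilon> lam Q G \<xi> \<zeta> k i \<omega> = iterate W \<epsilon> lam Q G \<xi>' \<zeta>' k i \<omega>'"
  using assms
proof (induction k arbitrary: i)
  case (Suc k)
  then have "iterate W \<epsilon> lam Q G \<xi> \<zeta> k i \<omega> = iterate W \<epsilon> lam Q G \<xi>' \<zeta>' k i \<omega>'" for i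
    by simp
  then show ?case
    by (simp add: Let_def Suc.prems)
qed simp

text \<open>Measurability is asked only of iterations before \<open>k\<close>, since on the product
  over \<open>{..<k}\<close> no later coordinate is available.\<close>

lemma iterate_measurable:
  assumes Q: "case_prod Q \<in> borel_measurable (borel \<Otimes>\<^sub>M Z)"
    and G: "\<And>k i. case_prod (G k i) \<in> borel_measurable (borel \<Otimes>\<^sub>M D i)"
    and \<xi>: "\<And>l i. l < k \<Longrightarrow> \<xi> l i \<in> measurable M (D i)"
    and \<zeta>: "\<And>l i. l < k \<Longrightarrow> \<zeta> l i \<in> measurable M Z"
  shows "iterate W \<epsilon> lam Q G \<xi> \<zeta> k i \<in> borel_measurable M"
  using \<xi> \<zeta>
proof (induction k arbitrary: i)
  case (Suc k)
  let ?x = "iterate W \<epsilon> lam Q G \<xi> \<zeta> k"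
  have x [measurable]: "?x i \<in> borel_measurable M" for i
    using Suc by simp
  have [measurable]: "(\<lambda>\<omega>. Q (?x j \<omega>) (\<zeta> k j \<omega>)) \<in> borel_measurable M" for j
    using measurable_compose[OF measurable_Pair[OF x Suc.prems(2)] Q] by simp
  have [measurable]: "(\<lambda>\<omega>. G k i (?x i \<omega>) (\<xi> k i \<omega>)) \<in> borel_measurable M" for i
    using measurable_compose[OF measurable_Pair[OF x Suc.prems(1)] G] by simp
  show ?case
    unfolding iterate.simps Let_def by measurable
qed simp

text \<open>The iterates at \<open>k\<close> are a measurable function of the randomness before
  \<open>k\<close>, which is independent of the randomness at \<open>k\<close>. The map
  \<open>g\<close> stands for whatever is read off the latter: one agent's sample or one agent's
  quantization noise.\<close>

lemma iterate_fresh_joint_law: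
  fixes \<xi> :: "nat \<Rightarrow> 'm::finite \<Rightarrow> 'w \<Rightarrow> 's" and \<zeta> :: "nat \<Rightarrow> 'm \<Rightarrow> 'w \<Rightarrow> 'z"
    and W :: "real^'m^'m" and G :: "nat \<Rightarrow> 'm \<Rightarrow> real^'d \<Rightarrow> 's \<Rightarrow> real^'d"
    and \<epsilon> lam :: "nat \<Rightarrow> real" and k :: nat
  assumes fresh: "fresh_randomness M D Z \<xi> \<zeta>"
    and Q: "case_prod Q \<in> borel_measurable (borel \<Otimes>\<^sub>M Z)"
    and G: "\<And>k i. case_prod (G k i) \<in> borel_measurable (borel \<Otimes>\<^sub>M D i)"
    and g: "g \<in> measurable ((\<Pi>\<^sub>M i\<in>UNIV. D i) \<Otimes>\<^sub>M (\<Pi>\<^sub>M i\<in>UNIV. Z)) T"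
  defines "X \<equiv> \<lambda>\<omega> i. iterate W \<epsilon> lam Q G \<xi> \<zeta> k i \<omega>"
    and "R \<equiv> \<lambda>\<omega>. g (\<lambda>i. \<xi> k i \<omega>, \<lambda>i. \<zeta> k i \<omega>)"
  shows "distr M ((\<Pi>\<^sub>M i\<in>UNIV. borel) \<Otimes>\<^sub>M T) (\<lambda>\<omega>. (X \<omega>, R \<omega>))
    = distr M (\<Pi>\<^sub>M i\<in>UNIV. borel) X \<Otimes>\<^sub>M distr M T R"
proof -
  interpret prob_space M
    using fresh by (simp add: fresh_randomness_def)
  define r where "r = (\<lambda>k \<omega>. (\<lambda>i. \<xi> k i \<omega>, \<lambda>i. \<zeta> k i \<omega>))"
  define N :: "nat \<Rightarrow> (('m \<Rightarrow> 's) \<times> ('m \<Rightarrow> 'z)) measure"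
    where "N = (\<lambda>k. (\<Pi>\<^sub>M i\<in>UNIV. D i) \<Otimes>\<^sub>M (\<Pi>\<^sub>M i\<in>UNIV. Z))"
  have "indep_vars N r UNIV"
    using fresh by (simp add: fresh_randomness_def N_def r_def)
  \<comment> \<open>Independence of the disjoint index blocks \<open>{..<k}\<close> and
    \<open>{k}\<close>; for \<open>k = 0\<close> the first block is empty.\<close>
  then have indep: "indep_var (PiM {..<k} N) (\<lambda>\<omega>. restrict (\<lambda>l. r l \<omega>) {..<k})
      (PiM {k} N) (\<lambda>\<omega>. restrict (\<lambda>l. r l \<omega>) {k})"
    by (rule indep_var_restrict) auto
  \<comment> \<open>The recursion itself, run on the space of histories, is the function that expresses the
    iterate through the randomness of the earlier iterations.\<close>
  define h where "h = (\<lambda>r i. iterate W \<epsilon> lam Q G (\<lambda>l i r. fst (r l) i) (\<lambda>l i r. snd (r l) i) k i r)"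
  have h: "h \<in> measurable (PiM {..<k} N) (\<Pi>\<^sub>M i\<in>UNIV. borel)"
  proof (rule measurable_PiM_single')
    fix i
    have "(\<lambda>r. fst (r l) i) \<in> measurable (PiM {..<k} N) (D i)"
      "(\<lambda>r. snd (r l) i) \<in> measurable (PiM {..<k} N) Z" if "l < k" for l i
    proof -
      have "(\<lambda>r. r l) \<in> measurable (PiM {..<k} N) ((\<Pi>\<^sub>M i\<in>UNIV. D i) \<Otimes>\<^sub>M (\<Pi>\<^sub>M i\<in>UNIV. Z))"
        using measurable_component_singleton[of l "{..<k}" N] that by (simp add: N_def)
      from measurable_compose[OF this measurable_fst] measurable_compose[OF this measurable_snd]
      show "(\<lambda>r. fst (r l) i) \<in> measurable (PiM {..<k} N) (D i)"
        "(\<lambda>r. snd (r l) i) \<in> measurable (PiM {..<k} N) Z"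
        by (auto intro: measurable_compose[OF _ measurable_component_singleton])
    qed
    then show "(\<lambda>r. h r i) \<in> borel_measurable (PiM {..<k} N)"
      unfolding h_def by (rule iterate_measurable[OF Q G])
  qed (simp add: space_PiM)
  have X_eq: "X \<omega> = h (restrict (\<lambda>l. r l \<omega>) {..<k})" for \<omega>
    unfolding h_def X_def by (rule ext, rule iterate_cong) (simp_all add: r_def)
  have g': "(\<lambda>q. g (q k)) \<in> measurable (PiM {k} N) T"
  proof (rule measurable_compose[where f="\<lambda>q. q k" and g=g])
    show "(\<lambda>q. q k) \<in> measurable (PiM {k} N) (N k)"
      by (rule measurable_component_singleton) simp
  qed (use g in \<open>simp add: N_def\<close>)
  let ?H = "\<lambda>\<omega>. restrict (\<lambda>l. r l \<omega>) {..<k}" and ?C = "\<lambda>\<omega>. restrict (\<lambda>l. r l \<omega>) {k}"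
  have H [measurable]: "?H \<in> measurable M (PiM {..<k} N)" and C [measurable]: "?C \<in> measurable M (PiM {k} N)"
    and HC: "distr M (PiM {..<k} N) ?H \<Otimes>\<^sub>M distr M (PiM {k} N) ?C
      = distr M (PiM {..<k} N \<Otimes>\<^sub>M PiM {k} N) (\<lambda>\<omega>. (?H \<omega>, ?C \<omega>))"
    using indep by (simp_all add: indep_var_distribution_eq)
  have R_eq: "R \<omega> = g (?C \<omega> k)" for \<omega>
    by (simp add: R_def r_def)
  have X_law: "distr M (\<Pi>\<^sub>M i\<in>UNIV. borel) X
      = distr (distr M (PiM {..<k} N) ?H) (\<Pi>\<^sub>M i\<in>UNIV. borel) h"
    using distr_distr[OF h H] by (simp add: comp_def X_eq[abs_def])
  have R_law: "distr M T R = distr (distr M (PiM {k} N) ?C) T (\<lambda>q. g (q k))"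
    using distr_distr[OF g' C] by (simp add: comp_def R_eq[abs_def])
  have R_meas: "R \<in> measurable M T"
    using measurable_compose[OF C g'] by (simp add: R_eq[abs_def])
  \<comment> \<open>Side condition for pushing a product measure forward componentwise.\<close>
  then have "sigma_finite_measure (distr (distr M (PiM {k} N) ?C) T (\<lambda>q. g (q k)))"
    unfolding R_law[symmetric]
    using prob_space_distr prob_space_imp_sigma_finite by blast
  then have "distr M (\<Pi>\<^sub>M i\<in>UNIV. borel) X \<Otimes>\<^sub>M distr M T R
      = distr (distr M (PiM {..<k} N \<Otimes>\<^sub>M PiM {k} N) (\<lambda>\<omega>. (?H \<omega>, ?C \<omega>)))
          ((\<Pi>\<^sub>M i\<in>UNIV. borel) \<Otimes>\<^sub>M T) (\<lambda>(p, q). (h p, g (q k)))"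
    unfolding X_law R_law HC[symmetric]
    using h g' by (intro pair_measure_distr) simp_all
  also have "\<dots> = distr M ((\<Pi>\<^sub>M i\<in>UNIV. borel) \<Otimes>\<^sub>M T) ((\<lambda>(p, q). (h p, g (q k))) \<circ> (\<lambda>\<omega>. (?H \<omega>, ?C \<omega>)))"
    by (rule distr_distr) (use h g' in measurable)
  finally show ?thesis
    by (simp add: comp_def X_eq[abs_def] R_eq[abs_def])
qed

subsection \<open>Averages of functions\<close>

lemma average_diff: "average u - average v = average (\<lambda>i. u i - v i)"
  for v :: "'m::finite \<Rightarrow> 'a::real_vector"
  by (simp add: average_def sum_subtractf scaleR_diff_right)

lemma norm_average_le:
  fixes v :: "'m::finite \<Rightarrow> 'a::real_normed_vector"
  assumes "\<And>i. norm (v i) \<le> c"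
  shows "norm (average v) \<le> c"
proof -
  have "norm (\<Sum>i\<in>UNIV. v i) \<le> real CARD('m) * c"
    using sum_norm_le[of UNIV v "\<lambda>_. c"] assms by simp
  then show ?thesis
    by (simp add: average_def field_simps)
qed

lemma lipschitz_on_average:
  fixes f :: "'m::finite \<Rightarrow> 'a::metric_space \<Rightarrow> 'b::real_normed_vector"
  assumes "\<And>i. C-lipschitz_on U (f i)"
  shows "C-lipschitz_on U (\<lambda>x. average (\<lambda>i. f i x))"
proof (rule lipschitz_onI)
  fix x y assume "x \<in> U" "y \<in> U"
  then have "norm (f i x - f i y) \<le> C * dist x y" for i
    using lipschitz_onD[OF assms[of i]] by (simp add: dist_norm)
  then show "dist (average (\<lambda>i. f i x)) (average (\<lambda>i. f i y)) \<le> C * dist x y"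
    unfolding dist_norm[of "average _"] average_diff by (rule norm_average_le)
qed (use lipschitz_on_nonneg[OF assms] in simp)

lemma convex_on_average:
  fixes f :: "'m::finite \<Rightarrow> 'a::real_vector \<Rightarrow> real"
  assumes "\<And>i. convex_on UNIV (f i)"
  shows "convex_on UNIV (\<lambda>x. average (\<lambda>i. f i x))"
proof -
  have "convex_on UNIV (\<lambda>x. \<Sum>i\<in>I. f i x)" if "finite I" for I
    using that assms by (induction I) (auto intro: convex_on_add simp: convex_on_const)
  from convex_on_cmul[OF _ this[of UNIV], of "1 / real CARD('m)"]
  show ?thesis by (simp add: average_def)
qed

text \<open>A Lipschitz function grows at most linearly.\<close>

lemma (in finite_measure) integrable_lipschitz:
  fixes g :: "'b::euclidean_space \<Rightarrow> real"
  assumes g: "C-lipschitz_on UNIV g" and y: "L2 M y"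
  shows "integrable M (\<lambda>\<omega>. g (y \<omega>))"
proof (rule Bochner_Integration.integrable_bound)
  show "integrable M (\<lambda>\<omega>. \<bar>g 0\<bar> + C * norm (y \<omega>))"
    using L2_integrable[OF y] by simp
  have "g \<in> borel_measurable borel"
    using g by (intro borel_measurable_continuous_onI lipschitz_on_continuous_on)
  then show "(\<lambda>\<omega>. g (y \<omega>)) \<in> borel_measurable M"
    using L2_measurable[OF y] by measurable
  have "\<bar>g (y \<omega>)\<bar> \<le> \<bar>g 0\<bar> + C * norm (y \<omega>)" for \<omega>
    using lipschitz_onD[OF g, of "y \<omega>" 0] by (simp add: dist_norm)
  then show "AE \<omega> in M. norm (g (y \<omega>)) \<le> norm (\<bar>g 0\<bar> + C * norm (y \<omega>))"
    by (auto intro: order_trans[OF _ abs_ge_self])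
qed

text \<open>The point \<open>c\<close> need not be the mean of \<open>Y\<close>: the lemma serves
  both for variances and for distances to \<open>xopt\<close>.\<close>

lemma second_moment_le:
  fixes Y :: "'r \<Rightarrow> 'b::euclidean_space"
  assumes "prob_space N" and Y: "Y \<in> borel_measurable N"
    and int: "integrable N (\<lambda>r. (norm (Y r - c))\<^sup>2)"
    and le: "(\<integral>r. (norm (Y r - c))\<^sup>2 \<partial>N) \<le> v"
  shows "integrable N (\<lambda>r. (norm (Y r))\<^sup>2)" "(\<integral>r. (norm (Y r))\<^sup>2 \<partial>N) \<le> 2 * v + 2 * (norm c)\<^sup>2"
proof -
  interpret N: prob_space N by fact
  have bound: "(norm (Y r))\<^sup>2 \<le> 2 * (norm (Y r - c))\<^sup>2 + 2 * (norm c)\<^sup>2" for r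
    using norm_add_sq_le[of "Y r - c" c] by simp
  have bi: "integrable N (\<lambda>r. 2 * (norm (Y r - c))\<^sup>2 + 2 * (norm c)\<^sup>2)"
    using int by simp
  show int': "integrable N (\<lambda>r. (norm (Y r))\<^sup>2)"
    using L2_bound[OF bi Y bound] by (simp add: L2_def)
  have "(\<integral>r. (norm (Y r))\<^sup>2 \<partial>N) \<le> (\<integral>r. 2 * (norm (Y r - c))\<^sup>2 + 2 * (norm c)\<^sup>2 \<partial>N)"
    by (rule integral_mono[OF int' bi bound])
  also have "\<dots> = 2 * (\<integral>r. (norm (Y r - c))\<^sup>2 \<partial>N) + 2 * (norm c)\<^sup>2"
    using int by (simp add: N.prob_space)
  finally show "(\<integral>r. (norm (Y r))\<^sup>2 \<partial>N) \<le> 2 * v + 2 * (norm c)\<^sup>2"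
    using le by linarith
qed

subsection \<open>Moments of the iterates\<close>

text \<open>The parameter \<open>C\<close> is one Lipschitz constant common to all agents, whereas
  \<open>gradient_assumption\<close> provides one for each agent.\<close>

locale quantized_gradient_method =
  fixes M :: "'w measure" and D :: "'m::finite \<Rightarrow> 's measure" and Z :: "'z measure"
    and F :: "'m \<Rightarrow> real^'d \<Rightarrow> 's \<Rightarrow> real"
    and G :: "nat \<Rightarrow> 'm \<Rightarrow> real^'d \<Rightarrow> 's \<Rightarrow> real^'d"
    and Q :: "real^'d \<Rightarrow> 'z \<Rightarrow> real^'d"
    and \<xi> :: "nat \<Rightarrow> 'm \<Rightarrow> 'w \<Rightarrow> 's" and \<zeta> :: "nat \<Rightarrow> 'm \<Rightarrow> 'w \<Rightarrow> 'z"
    and W :: "real^'m^'m" and \<epsilon> lam :: "nat \<Rightarrow> real"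
    and L \<sigma> \<beta> C :: real and xopt :: "real^'d"
  assumes randomness: "fresh_randomness M D Z \<xi> \<zeta>"
    and grad: "gradient_assumption D F G L \<sigma> xopt"
    and conn: "connectivity_assumption W"
    and quant: "quantizer_assumption Z Q \<beta>"
    and conv: "\<And>i. convex_on UNIV (local_objective D F i)"
    and lipschitz: "\<And>i. C-lipschitz_on UNIV (local_objective D F i)"
    and pos: "\<And>k. \<epsilon> k > 0" "\<And>k. lam k > 0"
begin

sublocale prob_space M
  using randomness by (simp add: fresh_randomness_def)

abbreviation "x \<equiv> iterate W \<epsilon> lam Q G \<xi> \<zeta>"
abbreviation "mean_x k \<omega> \<equiv> average (\<lambda>i. x k i \<omega>)"
abbreviation "quantized k i \<omega> \<equiv> Q (x k i \<omega>) (\<zeta> k i \<omega>)"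
abbreviation "sampled k i \<omega> \<equiv> G k i (x k i \<omega>) (\<xi> k i \<omega>)"
abbreviation "local_f \<equiv> local_objective D F"
abbreviation "global_f \<equiv> objective D F"

section \<open>Regularity of the local and global objectives\<close>

lemma C_nonneg: "0 \<le> C"
  using lipschitz lipschitz_on_nonneg by blast

lemma local_differentiable: "local_f i differentiable (at y)"
  using grad by (simp add: gradient_assumption_def)

lemma W_symmetric: "W $ i $ j = W $ j $ i"
  and W_nonneg: "0 \<le> W $ i $ j"
  and W_connected: "(i, j) \<in> {(a, b). b \<in> neighbors W a}\<^sup>*"
  using conn unfolding connectivity_assumption_def by blast+

lemma norm_local_gradient_le: "norm (gradient (local_f i) y) \<le> C"
  by (rule norm_gradient_le_lipschitz[OF conv local_differentiable lipschitz])

text \<open>The constant \<open>\<bar>L\<bar> + 1\<close> is positive whatever the sign of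
  \<open>L\<close>, as \<open>norm_gradient_sq_le\<close> demands.\<close>

lemma local_gradient_lipschitz:
  "norm (gradient (local_f i) y - gradient (local_f i) z) \<le> (\<bar>L\<bar> + 1) * norm (y - z)"
proof -
  have "norm (gradient (local_f i) y - gradient (local_f i) z) \<le> L * norm (y - z)"
    using grad by (simp add: gradient_assumption_def)
  also have "\<dots> \<le> (\<bar>L\<bar> + 1) * norm (y - z)"
    by (intro mult_right_mono) auto
  finally show ?thesis .
qed

lemma local_gradient_measurable [measurable]: "gradient (local_f i) \<in> borel_measurable borel"
proof -
  have "(\<bar>L\<bar> + 1)-lipschitz_on UNIV (gradient (local_f i))"
    using local_gradient_lipschitz by (intro lipschitz_onI) (auto simp: dist_norm)
  then show ?thesis
    by (intro borel_measurable_continuous_onI lipschitz_on_continuous_on)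
qed

lemma global_GDERIV: "GDERIV global_f y :> average (\<lambda>i. gradient (local_f i) y)"
  unfolding objective_def[abs_def]
  by (intro GDERIV_average GDERIV_gradient local_differentiable)

lemma global_gradient: "gradient global_f y = average (\<lambda>i. gradient (local_f i) y)"
  by (rule gradient_eqI[OF global_GDERIV])

lemma global_differentiable: "global_f differentiable (at y)"
  using global_GDERIV by (auto simp: gderiv_def differentiable_def)

lemma global_convex: "convex_on UNIV global_f"
  unfolding objective_def[abs_def] by (rule convex_on_average[OF conv])

lemma global_lipschitz: "C-lipschitz_on UNIV global_f"
  unfolding objective_def[abs_def] by (rule lipschitz_on_average[OF lipschitz])

lemma global_minimum: "global_f xopt \<le> global_f y"
  using grad by (simp add: gradient_assumption_def)

text \<open>This turns control of the optimality gap into control of squared gradients.\<close>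

lemma global_gradient_sq_le:
  "(norm (gradient global_f y))\<^sup>2 \<le> 4 * (\<bar>L\<bar> + 1) * (global_f y - global_f xopt)"
proof (rule norm_gradient_sq_le[OF global_convex global_differentiable _ _ global_minimum])
  show "norm (gradient global_f y - gradient global_f z) \<le> (\<bar>L\<bar> + 1) * norm (y - z)" for y z
    unfolding global_gradient average_diff
    by (rule norm_average_le[OF local_gradient_lipschitz])
qed auto

section \<open>Moments of one sample and one quantization\<close>

lemma \<xi>_measurable [measurable]: "\<xi> k i \<in> measurable M (D i)"
  and \<xi>_law: "distr M (D i) (\<xi> k i) = D i"
  and \<zeta>_measurable [measurable]: "\<zeta> k i \<in> measurable M Z"
  and \<zeta>_law: "distr M Z (\<zeta> k i) = Z"
  using randomness unfolding fresh_randomness_def by blast+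

lemma D_prob_space: "prob_space (D i)"
  and G_measurable: "case_prod (G k i) \<in> borel_measurable (borel \<Otimes>\<^sub>M D i)"
  and G_mean: "has_bochner_integral (D i) (G k i y) (gradient (local_f i) y)"
  and G_variance: "integrable (D i) (\<lambda>s. (norm (G k i y s - gradient (local_f i) y))\<^sup>2)"
    "(\<integral>s. (norm (G k i y s - gradient (local_f i) y))\<^sup>2 \<partial>D i) \<le> \<sigma>\<^sup>2"
  using grad unfolding gradient_assumption_def by blast+

lemma Z_prob_space: "prob_space Z"
  and Q_measurable: "case_prod Q \<in> borel_measurable (borel \<Otimes>\<^sub>M Z)"
  and Q_mean: "has_bochner_integral Z (Q y) y"
  and Q_variance: "integrable Z (\<lambda>z. (norm (Q y z - y))\<^sup>2)"
    "(\<integral>z. (norm (Q y z - y))\<^sup>2 \<partial>Z) \<le> \<beta> * (norm y)\<^sup>2"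
  using quant unfolding quantizer_assumption_def by blast+

text \<open>Local gradients are bounded by \<open>C\<close>, so the bound does not depend on the
  point and the sampled gradients are square integrable along any trajectory.\<close>

lemma G_second_moment:
  "integrable (D i) (\<lambda>s. (norm (G k i y s))\<^sup>2)"
  "(\<integral>s. (norm (G k i y s))\<^sup>2 \<partial>D i) \<le> 2 * \<sigma>\<^sup>2 + 2 * C\<^sup>2"
proof -
  have "G k i y \<in> borel_measurable (D i)"
    using G_mean by (rule borel_measurable_has_bochner_integral)
  note * = second_moment_le[OF D_prob_space this G_variance]
  show "integrable (D i) (\<lambda>s. (norm (G k i y s))\<^sup>2)" by (rule *(1))
  have "(norm (gradient (local_f i) y))\<^sup>2 \<le> C\<^sup>2"
    by (intro power_mono norm_local_gradient_le) simp
  with *(2) show "(\<integral>s. (norm (G k i y s))\<^sup>2 \<partial>D i) \<le> 2 * \<sigma>\<^sup>2 + 2 * C\<^sup>2"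
    by linarith
qed

text \<open>The bound grows with the quantized point; this is the source of the factor
  \<open>1 + a * (\<epsilon> k)\<^sup>2\<close> in the Lyapunov inequality.\<close>

lemma Q_second_moment:
  "integrable Z (\<lambda>z. (norm (Q y z))\<^sup>2)"
  "(\<integral>z. (norm (Q y z))\<^sup>2 \<partial>Z) \<le> 2 * (\<beta> + 1) * (norm y)\<^sup>2"
proof -
  have "Q y \<in> borel_measurable Z"
    using Q_mean by (rule borel_measurable_has_bochner_integral)
  note * = second_moment_le[OF Z_prob_space this Q_variance]
  show "integrable Z (\<lambda>z. (norm (Q y z))\<^sup>2)" by (rule *(1))
  show "(\<integral>z. (norm (Q y z))\<^sup>2 \<partial>Z) \<le> 2 * (\<beta> + 1) * (norm y)\<^sup>2"
    using *(2) by (simp add: algebra_simps)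
qed

lemma x_measurable [measurable]: "x k i \<in> borel_measurable M"
  by (rule iterate_measurable[OF Q_measurable G_measurable]) auto

section \<open>Moments along the iterates, by conditioning on the current state\<close>

abbreviation "joint k \<omega> \<equiv> (\<lambda>i. x k i \<omega>)"
abbreviation "state \<equiv> (\<Pi>\<^sub>M i\<in>(UNIV::'m set). (borel :: (real^'d) measure))"

text \<open>The state consists of the iterates of all agents together, because the cross terms pair
  the iterate of agent \<open>i\<close> with the quantized value of another agent
  \<open>j\<close>.\<close>

lemma joint_measurable: "joint k \<in> measurable M state"
  by (intro measurable_PiM_single') (auto simp: space_PiM)

lemma joint_\<zeta>_law: "distr M (state \<Otimes>\<^sub>M Z) (\<lambda>\<omega>. (joint k \<omega>, \<zeta> k j \<omega>)) = distr M state (joint k) \<Otimes>\<^sub>M Z"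
  using iterate_fresh_joint_law[OF randomness Q_measurable G_measurable,
      where g="\<lambda>r. snd r j" and T=Z and k=k and W=W and \<epsilon>=\<epsilon> and lam=lam] 
  by (auto simp: \<zeta>_law)

lemma joint_\<xi>_law: "distr M (state \<Otimes>\<^sub>M D j) (\<lambda>\<omega>. (joint k \<omega>, \<xi> k j \<omega>)) = distr M state (joint k) \<Otimes>\<^sub>M D j"
  using iterate_fresh_joint_law[OF randomness Q_measurable G_measurable,
      where g="\<lambda>r. fst r j" and T="D j" and k=k and W=W and \<epsilon>=\<epsilon> and lam=lam]
  by (auto simp: \<xi>_law)

lemma component_measurable [measurable]: "(\<lambda>X. X i) \<in> borel_measurable state"
  by (rule measurable_component_singleton) simp

lemma quantized_measurable: "(\<lambda>(X, z). Q (X j) z) \<in> borel_measurable (state \<Otimes>\<^sub>M Z)"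
proof -
  have "(\<lambda>p. (fst p j, snd p)) \<in> measurable (state \<Otimes>\<^sub>M Z) (borel \<Otimes>\<^sub>M Z)"
    by measurable
  from measurable_compose[OF this Q_measurable] show ?thesis
    by (simp add: case_prod_beta')
qed

lemma quantized_L2:
  assumes "L2 M (x k j)"
  shows "L2 M (quantized k j)"
    and "(\<integral>\<omega>. (norm (quantized k j \<omega>))\<^sup>2 \<partial>M) \<le> 2 * (\<beta> + 1) * (\<integral>\<omega>. (norm (x k j \<omega>))\<^sup>2 \<partial>M)"
proof -
  have bound: "integrable M (\<lambda>\<omega>. 2 * (\<beta> + 1) * (norm (x k j \<omega>))\<^sup>2)"
    using assms by (simp add: L2_def)
  have meas: "(\<lambda>X. 2 * (\<beta> + 1) * (norm (X j))\<^sup>2) \<in> borel_measurable state"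
    by measurable
  note * = fresh_second_moment[where R="\<zeta> k j" and X="joint k" and \<phi>="\<lambda>X z. Q (X j) z"
      and b="\<lambda>X. 2 * (\<beta> + 1) * (norm (X j))\<^sup>2",
      OF Z_prob_space joint_measurable \<zeta>_measurable joint_\<zeta>_law quantized_measurable
      Q_second_moment meas bound]
  show "L2 M (quantized k j)"
    by (rule *(1))
  show "(\<integral>\<omega>. (norm (quantized k j \<omega>))\<^sup>2 \<partial>M) \<le> 2 * (\<beta> + 1) * (\<integral>\<omega>. (norm (x k j \<omega>))\<^sup>2 \<partial>M)"
    using *(2) by simp
qed

lemma quantized_mean:
  assumes "\<And>i. L2 M (x k i)"
  shows "(\<integral>\<omega>. (x k i \<omega> - c) \<bullet> quantized k j \<omega> \<partial>M) = (\<integral>\<omega>. (x k i \<omega> - c) \<bullet> x k j \<omega> \<partial>M)"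
  by (rule fresh_mean[OF Z_prob_space joint_measurable \<zeta>_measurable joint_\<zeta>_law quantized_measurable Q_mean,
          where u="\<lambda>X. X i - c"])
       (use assms quantized_L2 in \<open>auto intro: L2_diff L2_const\<close>)

lemma sampled_measurable:
  "(\<lambda>(X, s). G k j (X j) s) \<in> borel_measurable (state \<Otimes>\<^sub>M D j)"
proof -
  have "(\<lambda>p. (fst p j, snd p)) \<in> measurable (state \<Otimes>\<^sub>M D j) (borel \<Otimes>\<^sub>M D j)"
    by measurable
  from measurable_compose[OF this G_measurable] show ?thesis
    by (simp add: case_prod_beta')
qed

lemma sampled_L2:
  shows "L2 M (sampled k j)"
    and "(\<integral>\<omega>. (norm (sampled k j \<omega>))\<^sup>2 \<partial>M) \<le> 2 * \<sigma>\<^sup>2 + 2 * C\<^sup>2"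
proof -
  have bound: "integrable M (\<lambda>\<omega>. 2 * \<sigma>\<^sup>2 + 2 * C\<^sup>2)" by simp
  note * = fresh_second_moment[where R="\<xi> k j" and X="joint k" and \<phi>="\<lambda>X s. G k j (X j) s",
      OF D_prob_space joint_measurable \<xi>_measurable joint_\<xi>_law sampled_measurable G_second_moment
      borel_measurable_const bound]
  show "L2 M (sampled k j)"
    by (rule *(1))
  show "(\<integral>\<omega>. (norm (sampled k j \<omega>))\<^sup>2 \<partial>M) \<le> 2 * \<sigma>\<^sup>2 + 2 * C\<^sup>2"
    using *(2) by (simp add: prob_space)
qed

lemma sampled_mean:
  assumes "\<And>i. L2 M (x k i)"
  shows "(\<integral>\<omega>. (x k j \<omega> - c) \<bullet> sampled k j \<omega> \<partial>M)
    = (\<integral>\<omega>. (x k j \<omega> - c) \<bullet> gradient (local_f j) (x k j \<omega>) \<partial>M)"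
  by (rule fresh_mean[OF D_prob_space joint_measurable \<xi>_measurable joint_\<xi>_law
        sampled_measurable G_mean, where u="\<lambda>X. X j - c"])
     (use assms sampled_L2 in \<open>auto intro: L2_diff L2_const\<close>)

abbreviation "consensus_term k i \<omega> \<equiv> (\<Sum>j\<in>UNIV. W $ i $ j *\<^sub>R (quantized k i \<omega> - quantized k j \<omega>))"

text \<open>Agents that are not neighbours have weight zero, so the sum may run over all agents. The
  sign is chosen so that the consensus term is the Laplacian applied to the quantized
  values.\<close>

lemma x_Suc: "x (Suc k) i = (\<lambda>\<omega>. x k i \<omega>
    - (\<epsilon> k *\<^sub>R consensus_term k i \<omega> + (\<epsilon> k * lam k) *\<^sub>R sampled k i \<omega>))"
proof
  fix \<omega>
  have "(\<Sum>j\<in>neighbors W i. W $ i $ j *\<^sub>R (quantized k j \<omega> - quantized k i \<omega>))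
      = (\<Sum>j\<in>UNIV. W $ i $ j *\<^sub>R (quantized k j \<omega> - quantized k i \<omega>))"
  proof (rule sum.mono_neutral_left)
    show "\<forall>j\<in>UNIV - neighbors W i. W $ i $ j *\<^sub>R (quantized k j \<omega> - quantized k i \<omega>) = 0"
      using W_nonneg by (auto simp: neighbors_def antisym_conv2 less_le)
  qed auto
  also have "\<dots> = - consensus_term k i \<omega>"
    unfolding sum_negf[symmetric] by (intro sum.cong refl) (simp add: scaleR_diff_right)
  finally show "x (Suc k) i \<omega> = x k i \<omega>
    - (\<epsilon> k *\<^sub>R consensus_term k i \<omega> + (\<epsilon> k * lam k) *\<^sub>R sampled k i \<omega>)"
    by (simp add: Let_def)
qed

lemma x_L2: "L2 M (x k i)"
proof (induction k arbitrary: i)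
  case (Suc k)
  then show ?case
    unfolding x_Suc
    by (intro L2_diff L2_add L2_scaleR L2_sum quantized_L2(1) sampled_L2(1))
qed (simp add: L2_const)

end

subsection \<open>The Lyapunov inequality\<close>

text \<open>The numerator converges and the denominator diverges. Every limit in the theorem is
  thereby reduced to the summability of one weighted series.\<close>

lemma weighted_average_tendsto_0:
  fixes a h :: "nat \<Rightarrow> real"
  assumes div: "filterlim (\<lambda>t. \<Sum>k=0..t. a k) at_top sequentially"
    and sum: "summable (\<lambda>k. a k * h k)"
  shows "(\<lambda>t. (\<Sum>k=0..t. a k * h k) / (\<Sum>k=0..t. a k)) \<longlonglongrightarrow> 0"
proof -
  have "(\<lambda>t. \<Sum>k=0..t. a k * h k) \<longlonglongrightarrow> (\<Sum>k. a k * h k)"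
    using summable_LIMSEQ'[OF sum] by (simp add: atLeast0AtMost)
  then show ?thesis
    using div by (rule real_tendsto_divide_at_top)
qed

lemma convex_on_weighted_average:
  fixes f :: "'a::real_vector \<Rightarrow> real"
  assumes "convex_on UNIV f" "finite I" "I \<noteq> {}" and a: "\<And>i. i \<in> I \<Longrightarrow> a i > 0"
  shows "f ((\<Sum>i\<in>I. a i *\<^sub>R y i) /\<^sub>R sum a I) \<le> (\<Sum>i\<in>I. a i * f (y i)) / sum a I"
proof -
  have A: "sum a I > 0"
    using assms by (intro sum_pos) auto
  have "f (\<Sum>i\<in>I. (a i / sum a I) *\<^sub>R y i) \<le> (\<Sum>i\<in>I. a i / sum a I * f (y i))"
    using A assms by (intro convex_on_sum) (auto simp: sum_divide_distrib[symmetric] less_imp_le)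
  moreover have "(\<Sum>i\<in>I. a i / sum a I * f (y i)) = (\<Sum>i\<in>I. a i * f (y i)) / sum a I"
    by (simp add: sum_divide_distrib)
  ultimately show ?thesis
    by (simp add: scaleR_sum_right divide_inverse_commute)
qed

context quantized_gradient_method
begin

text \<open>Young's inequality \<open>2 \<lambda> C a \<le> \<kappa> a\<^sup>2 / 2 + 2 C\<^sup>2 \<lambda>\<^sup>2 / \<kappa>\<close> lets the
  consensus term absorb the error of evaluating the local gradients away from the mean.\<close>

lemma drift_le:
  fixes v :: "'m \<Rightarrow> real^'d"
  assumes \<kappa>: "\<kappa> > 0" and poincare: "\<kappa> * (\<Sum>i\<in>UNIV. (norm (v i - average v))\<^sup>2) \<le> dirichlet W v"
    and l: "l > 0"
  shows "- dirichlet W v - 2 * l * (\<Sum>i\<in>UNIV. (v i - xopt) \<bullet> gradient (local_f i) (v i))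
    \<le> - (\<kappa> / 2) * (\<Sum>i\<in>UNIV. (norm (v i - average v))\<^sup>2)
      - 2 * l * real CARD('m) * (global_f (average v) - global_f xopt)
      + 2 * real CARD('m) * C\<^sup>2 / \<kappa> * l\<^sup>2"
proof -
  let ?n = "\<lambda>i. norm (v i - average v)"
  have each: "- 2 * l * ((v i - xopt) \<bullet> gradient (local_f i) (v i))
      \<le> \<kappa> / 2 * (?n i)\<^sup>2 - 2 * l * (local_f i (average v) - local_f i xopt) + 2 * C\<^sup>2 / \<kappa> * l\<^sup>2" for i
  proof -
    \<comment> \<open>Convexity compares the agent's own point with the optimum; the Lipschitz bound
      then moves the function value from that point to the mean.\<close>
    have "local_f i (v i) + gradient (local_f i) (v i) \<bullet> (xopt - v i) \<le> local_f i xopt"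
      by (rule convex_gradient_le[OF conv local_differentiable])
    moreover have "local_f i (average v) - local_f i (v i) \<le> C * ?n i"
      using lipschitz_onD[OF lipschitz[of i], of "average v" "v i"]
      by (simp add: dist_norm norm_minus_commute)
    moreover have "gradient (local_f i) (v i) \<bullet> (xopt - v i)
        = - ((v i - xopt) \<bullet> gradient (local_f i) (v i))"
      by (simp add: inner_diff_left inner_diff_right inner_commute)
    ultimately have "- ((v i - xopt) \<bullet> gradient (local_f i) (v i))
        \<le> C * ?n i - (local_f i (average v) - local_f i xopt)"
      by linarith
    from mult_left_mono[OF this, of "2 * l"] l
    have "- 2 * l * ((v i - xopt) \<bullet> gradient (local_f i) (v i))
        \<le> 2 * l * (C * ?n i) - 2 * l * (local_f i (average v) - local_f i xopt)"
      by (simp add: algebra_simps)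
    moreover have "2 * l * (C * ?n i) \<le> \<kappa> / 2 * (?n i)\<^sup>2 + 2 * C\<^sup>2 / \<kappa> * l\<^sup>2"
    proof -
      have "0 \<le> (\<kappa> * ?n i - 2 * C * l)\<^sup>2 / (2 * \<kappa>)"
        using \<kappa> by simp
      also have "\<dots> = \<kappa> / 2 * (?n i)\<^sup>2 + 2 * C\<^sup>2 / \<kappa> * l\<^sup>2 - 2 * l * (C * ?n i)"
        using \<kappa> by (simp add: power2_diff field_simps power2_eq_square)
      finally show ?thesis by simp
    qed
    ultimately show ?thesis by linarith
  qed
  have "- 2 * l * (\<Sum>i\<in>UNIV. (v i - xopt) \<bullet> gradient (local_f i) (v i))
      = (\<Sum>i\<in>UNIV. - 2 * l * ((v i - xopt) \<bullet> gradient (local_f i) (v i)))"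
    by (simp add: sum_distrib_left)
  also have "\<dots> \<le> (\<Sum>i\<in>UNIV. \<kappa> / 2 * (?n i)\<^sup>2 - 2 * l * (local_f i (average v) - local_f i xopt)
      + 2 * C\<^sup>2 / \<kappa> * l\<^sup>2)"
    by (intro sum_mono each)
  also have "\<dots> = \<kappa> / 2 * (\<Sum>i\<in>UNIV. (?n i)\<^sup>2)
      - 2 * l * ((\<Sum>i\<in>UNIV. local_f i (average v)) - (\<Sum>i\<in>UNIV. local_f i xopt))
      + real CARD('m) * (2 * C\<^sup>2 / \<kappa> * l\<^sup>2)"
    by (simp add: sum.distrib sum_subtractf sum_distrib_left right_diff_distrib)
  also have "\<dots> = \<kappa> / 2 * (\<Sum>i\<in>UNIV. (?n i)\<^sup>2)
      - 2 * l * real CARD('m) * (global_f (average v) - global_f xopt)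
      + 2 * real CARD('m) * C\<^sup>2 / \<kappa> * l\<^sup>2"
  proof -
    have "(\<Sum>i\<in>UNIV. local_f i y) = real CARD('m) * global_f y" for y
      by (simp add: objective_def average_def)
    then show ?thesis
      by (simp add: algebra_simps)
  qed
  \<comment> \<open>The Dirichlet form supplies \<open>\<kappa>\<close> times the disagreement; half
    of it pays for Young's inequality and half remains.\<close>
  finally show ?thesis
    using poincare by simp
qed

text \<open>A crude bound suffices, as this term enters with the factor
  \<open>(\<epsilon> k)\<^sup>2\<close>. Each weight is at most \<open>w\<close> and each difference
  at most twice the sum of the norms; the third power of the number of agents comes from squaring
  the number of summands and from Cauchy-Schwarz.\<close>

lemma norm_consensus_term_sq_le:
  fixes v :: "'m \<Rightarrow> real^'d"
  defines "w \<equiv> \<Sum>i\<in>UNIV. \<Sum>j\<in>UNIV. W $ i $ j"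
  shows "(norm (\<Sum>j\<in>UNIV. W $ i $ j *\<^sub>R (v i - v j)))\<^sup>2
    \<le> 4 * w\<^sup>2 * real CARD('m) ^ 3 * (\<Sum>j\<in>UNIV. (norm (v j))\<^sup>2)"
proof -
  let ?s = "\<Sum>j\<in>UNIV. norm (v j)"
  have le_w: "W $ i $ j \<le> w" for i j
  proof -
    have "W $ i $ j \<le> (\<Sum>j\<in>UNIV. W $ i $ j)"
      by (rule member_le_sum) (simp_all add: W_nonneg)
    also have "\<dots> \<le> w"
      unfolding w_def by (rule member_le_sum) (simp_all add: W_nonneg sum_nonneg)
    finally show ?thesis .
  qed
  have "w \<ge> 0"
    unfolding w_def by (intro sum_nonneg W_nonneg)
  have "norm (W $ i $ j *\<^sub>R (v i - v j)) \<le> w * (2 * ?s)" for j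
  proof -
    have "norm (v j) \<le> ?s" for j
      by (rule member_le_sum) auto
    from this[of i] this[of j] have "norm (v i - v j) \<le> 2 * ?s"
      using norm_triangle_ineq4[of "v i" "v j"] by linarith
    then show ?thesis
      using le_w[of i j] W_nonneg[of i j] \<open>w \<ge> 0\<close> by (auto intro!: mult_mono)
  qed
  then have "norm (\<Sum>j\<in>UNIV. W $ i $ j *\<^sub>R (v i - v j)) \<le> real CARD('m) * (w * (2 * ?s))"
    using sum_norm_le[of UNIV "\<lambda>j. W $ i $ j *\<^sub>R (v i - v j)" "\<lambda>_. w * (2 * ?s)"] by simp
  then have "(norm (\<Sum>j\<in>UNIV. W $ i $ j *\<^sub>R (v i - v j)))\<^sup>2 \<le> (real CARD('m) * (w * (2 * ?s)))\<^sup>2"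
    by (rule power_mono) simp
  also have "\<dots> = 4 * w\<^sup>2 * (real CARD('m))\<^sup>2 * ?s\<^sup>2"
    by (simp add: power_mult_distrib)
  also have "\<dots> \<le> 4 * w\<^sup>2 * (real CARD('m))\<^sup>2 * ((\<Sum>j\<in>UNIV. (norm (v j))\<^sup>2) * real CARD('m))"
    by (intro mult_left_mono sum_squared_le_sum_of_squares) auto
  finally show ?thesis
    by (simp add: power2_eq_square power3_eq_cube mult_ac)
qed

definition distance_sq :: "nat \<Rightarrow> real" where
  "distance_sq k = (\<Sum>i\<in>UNIV. \<integral>\<omega>. (norm (x k i \<omega> - xopt))\<^sup>2 \<partial>M)"

definition disagreement :: "nat \<Rightarrow> real" where
  "disagreement k = (\<Sum>i\<in>UNIV. \<integral>\<omega>. (norm (x k i \<omega> - mean_x k \<omega>))\<^sup>2 \<partial>M)"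

definition gap :: "nat \<Rightarrow> real" where
  "gap k = (\<integral>\<omega>. global_f (mean_x k \<omega>) - global_f xopt \<partial>M)"

lemma mean_x_L2: "L2 M (mean_x k)"
  by (intro L2_average x_L2)

lemma gradient_x_L2: "L2 M (\<lambda>\<omega>. gradient (local_f i) (x k i \<omega>))"
proof (rule L2_bound)
  show "(norm (gradient (local_f i) (x k i \<omega>)))\<^sup>2 \<le> C\<^sup>2" for \<omega>
    by (intro power_mono norm_local_gradient_le) simp
qed auto

lemma global_f_mean_x_integrable: "integrable M (\<lambda>\<omega>. global_f (mean_x k \<omega>))"
  by (rule integrable_lipschitz[OF global_lipschitz mean_x_L2])

lemma distance_sq_nonneg: "0 \<le> distance_sq k"
  unfolding distance_sq_def by (intro sum_nonneg Bochner_Integration.integral_nonneg) simp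

lemma disagreement_nonneg: "0 \<le> disagreement k"
  unfolding disagreement_def by (intro sum_nonneg Bochner_Integration.integral_nonneg) simp

lemma gap_nonneg: "0 \<le> gap k"
  unfolding gap_def by (intro Bochner_Integration.integral_nonneg) (simp only: diff_ge_0_iff_ge global_minimum)

text \<open>Quantization noise scales with the distance to the origin, while the Lyapunov function
  measures the distance to \<open>xopt\<close>; the shift costs the constant term.\<close>

lemma sum_second_moment_le:
  "(\<Sum>i\<in>UNIV. \<integral>\<omega>. (norm (x k i \<omega>))\<^sup>2 \<partial>M) \<le> 2 * distance_sq k + 2 * real CARD('m) * (norm xopt)\<^sup>2"
proof -
  have "(\<integral>\<omega>. (norm (x k i \<omega>))\<^sup>2 \<partial>M) \<le> 2 * (\<integral>\<omega>. (norm (x k i \<omega> - xopt))\<^sup>2 \<partial>M) + 2 * (norm xopt)\<^sup>2" for i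
    by (rule second_moment_le(2)[OF prob_space_axioms x_measurable
          L2_integrable_sq[OF L2_diff[OF x_L2 L2_const]] order_refl])
  then have "(\<Sum>i\<in>UNIV. \<integral>\<omega>. (norm (x k i \<omega>))\<^sup>2 \<partial>M)
      \<le> (\<Sum>i\<in>UNIV. 2 * (\<integral>\<omega>. (norm (x k i \<omega> - xopt))\<^sup>2 \<partial>M) + 2 * (norm xopt)\<^sup>2)"
    by (rule sum_mono)
  then show ?thesis
    by (simp add: distance_sq_def sum.distrib sum_distrib_left)
qed

text \<open>Expanding the square leaves a cross term, the drift, which unbiasedness makes explicit,
  and a squared step, the noise, of order \<open>(\<epsilon> k)\<^sup>2\<close>. The constants are
  the same for all iterations.\<close>

lemma distance_sq_Suc_le:
  obtains \<kappa> a b where "\<kappa> > 0" "a \<ge> 0" "b \<ge> 0"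
    "\<And>k. distance_sq (Suc k) \<le> (1 + a * (\<epsilon> k)\<^sup>2) * distance_sq k
      - (\<kappa> * (\<epsilon> k * disagreement k) + 2 * real CARD('m) * (\<epsilon> k * lam k * gap k))
      + b * ((\<epsilon> k)\<^sup>2 + \<epsilon> k * (lam k)\<^sup>2 + (\<epsilon> k)\<^sup>2 * (lam k)\<^sup>2)"
proof -
  obtain \<kappa> where \<kappa>: "\<kappa> > 0"
    "\<And>v :: 'm \<Rightarrow> real^'d. \<kappa> * (\<Sum>i\<in>UNIV. (norm (v i - average v))\<^sup>2) \<le> dirichlet W v"
    using connected_imp_poincare[OF W_nonneg W_connected] by metis
  define m where "m = real CARD('m)"
  \<comment> \<open>\<open>K\<close> is the constant of \<open>norm_consensus_term_sq_le\<close>;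
    \<open>B\<close> majorises that of \<open>Q_second_moment\<close>, with an absolute value to be
    nonnegative for any \<open>\<beta>\<close>. The constant \<open>b\<close> adds up the
    coefficients of the three error sequences, so it dominates each of them.\<close>
  define K where "K = 4 * (\<Sum>i\<in>UNIV. \<Sum>j\<in>UNIV. W $ i $ j)\<^sup>2 * m ^ 3"
  define B where "B = 2 * (\<bar>\<beta>\<bar> + 1)"
  define a where "a = 4 * m * K * B"
  define b where "b = 2 * m * C\<^sup>2 / \<kappa> + 4 * m\<^sup>2 * K * B * (norm xopt)\<^sup>2 + 2 * m * (2 * \<sigma>\<^sup>2 + 2 * C\<^sup>2)"
  have m: "m \<ge> 0" by (simp add: m_def)
  have K: "K \<ge> 0" unfolding K_def using m by simp
  have B: "B \<ge> 0" by (simp add: B_def)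
  have step: "distance_sq (Suc k) \<le> (1 + a * (\<epsilon> k)\<^sup>2) * distance_sq k
      - (\<kappa> / 2 * (\<epsilon> k * disagreement k) + 2 * m * (\<epsilon> k * lam k * gap k))
      + b * ((\<epsilon> k)\<^sup>2 + \<epsilon> k * (lam k)\<^sup>2 + (\<epsilon> k)\<^sup>2 * (lam k)\<^sup>2)" for k
  proof -
    define p where "p = consensus_term k"
    define d where "d = (\<lambda>i \<omega>. \<epsilon> k *\<^sub>R p i \<omega> + (\<epsilon> k * lam k) *\<^sub>R sampled k i \<omega>)"
    have q_L2: "L2 M (quantized k i)" for i
      by (rule quantized_L2(1)[OF x_L2])
    have p_L2: "L2 M (p i)" for i
      unfolding p_def by (intro L2_sum L2_scaleR L2_diff q_L2)
    have d_L2: "L2 M (d i)" for i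
      unfolding d_def by (intro L2_add L2_scaleR p_L2 sampled_L2(1))
    have xc_L2: "L2 M (\<lambda>\<omega>. x k i \<omega> - xopt)" for i
      by (intro L2_diff x_L2 L2_const)
    note ints = L2_integrable_inner[OF xc_L2 q_L2] L2_integrable_inner[OF xc_L2 x_L2]
      L2_integrable_inner[OF xc_L2 p_L2] L2_integrable_inner[OF xc_L2 sampled_L2(1)]
      L2_integrable_inner[OF xc_L2 gradient_x_L2] L2_integrable_inner[OF xc_L2 d_L2]
      L2_integrable_sq[OF xc_L2] L2_integrable_sq[OF d_L2] L2_integrable_sq[OF p_L2]
      L2_integrable_sq[OF sampled_L2(1)] L2_integrable_sq[OF q_L2]
    have "(\<integral>\<omega>. (norm (x (Suc k) i \<omega> - xopt))\<^sup>2 \<partial>M)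
        = (\<integral>\<omega>. (norm (x k i \<omega> - xopt))\<^sup>2 \<partial>M) - 2 * (\<integral>\<omega>. (x k i \<omega> - xopt) \<bullet> d i \<omega> \<partial>M)
          + (\<integral>\<omega>. (norm (d i \<omega>))\<^sup>2 \<partial>M)" for i
    proof -
      have "(norm (x (Suc k) i \<omega> - xopt))\<^sup>2
          = (norm (x k i \<omega> - xopt))\<^sup>2 - 2 * ((x k i \<omega> - xopt) \<bullet> d i \<omega>) + (norm (d i \<omega>))\<^sup>2" for \<omega>
      proof -
        have "x (Suc k) i \<omega> - xopt = (x k i \<omega> - xopt) - d i \<omega>"
          unfolding x_Suc by (simp add: d_def p_def)
        then show ?thesis
          by (simp only: power2_norm_eq_inner) (simp add: inner_diff inner_commute)
      qed
      then show ?thesis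
        using ints by simp
    qed
    then have expand: "distance_sq (Suc k) = distance_sq k
        - 2 * (\<Sum>i\<in>UNIV. \<integral>\<omega>. (x k i \<omega> - xopt) \<bullet> d i \<omega> \<partial>M) + (\<Sum>i\<in>UNIV. \<integral>\<omega>. (norm (d i \<omega>))\<^sup>2 \<partial>M)"
      by (simp add: distance_sq_def sum.distrib sum_subtractf sum_distrib_left)

    \<comment> \<open>The test vector depends on the state alone, so both quantized values in each
      difference may be replaced by the exact iterates.\<close>
    have inner_p: "(\<integral>\<omega>. (x k i \<omega> - xopt) \<bullet> p i \<omega> \<partial>M)
        = (\<integral>\<omega>. (\<Sum>j\<in>UNIV. W $ i $ j * ((x k i \<omega> - xopt) \<bullet> (x k i \<omega> - x k j \<omega>))) \<partial>M)" for i
      using ints quantized_mean[OF x_L2]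
      by (simp add: p_def inner_sum_right inner_diff_right)
    have inner_d: "(\<integral>\<omega>. (x k i \<omega> - xopt) \<bullet> d i \<omega> \<partial>M)
        = \<epsilon> k * (\<integral>\<omega>. (\<Sum>j\<in>UNIV. W $ i $ j * ((x k i \<omega> - xopt) \<bullet> (x k i \<omega> - x k j \<omega>))) \<partial>M)
          + \<epsilon> k * lam k * (\<integral>\<omega>. (x k i \<omega> - xopt) \<bullet> gradient (local_f i) (x k i \<omega>) \<partial>M)" for i
      using ints sampled_mean[OF x_L2]
      by (simp add: d_def inner_add_right inner_p)
    have int_diff: "integrable M (\<lambda>\<omega>. (x k i \<omega> - xopt) \<bullet> (x k i \<omega> - x k j \<omega>))" for i j
      by (intro L2_integrable_inner xc_L2 L2_diff x_L2)
    have int_dir: "integrable M (\<lambda>\<omega>. dirichlet W (\<lambda>i. x k i \<omega>))"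
      unfolding dirichlet_def using L2_integrable_sq[OF L2_diff[OF x_L2 x_L2]] by simp
    have int_dis: "integrable M (\<lambda>\<omega>. (norm (x k i \<omega> - mean_x k \<omega>))\<^sup>2)" for i
      by (intro L2_integrable_sq L2_diff x_L2 mean_x_L2)
    \<comment> \<open>Twice the consensus cross terms, summed over the agents, is exactly the
      expected Dirichlet form.\<close>
    have "- 2 * (\<Sum>i\<in>UNIV. \<integral>\<omega>. (x k i \<omega> - xopt) \<bullet> d i \<omega> \<partial>M)
        = \<epsilon> k * (\<integral>\<omega>. - dirichlet W (\<lambda>i. x k i \<omega>)
            - 2 * lam k * (\<Sum>i\<in>UNIV. (x k i \<omega> - xopt) \<bullet> gradient (local_f i) (x k i \<omega>)) \<partial>M)"
    proof -
      have "(\<integral>\<omega>. dirichlet W (\<lambda>i. x k i \<omega>) \<partial>M)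
          = 2 * (\<Sum>i\<in>UNIV. \<integral>\<omega>. (\<Sum>j\<in>UNIV. W $ i $ j * ((x k i \<omega> - xopt) \<bullet> (x k i \<omega> - x k j \<omega>))) \<partial>M)"
        unfolding sum_symmetric_weights[OF W_symmetric, where c=xopt, symmetric]
        using int_diff by simp
      moreover have "(\<integral>\<omega>. - dirichlet W (\<lambda>i. x k i \<omega>)
            - 2 * lam k * (\<Sum>i\<in>UNIV. (x k i \<omega> - xopt) \<bullet> gradient (local_f i) (x k i \<omega>)) \<partial>M)
          = - (\<integral>\<omega>. dirichlet W (\<lambda>i. x k i \<omega>) \<partial>M)
            - 2 * lam k * (\<Sum>i\<in>UNIV. \<integral>\<omega>. (x k i \<omega> - xopt) \<bullet> gradient (local_f i) (x k i \<omega>) \<partial>M)"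
        using ints int_dir by simp
      ultimately show ?thesis
        unfolding inner_d sum.distrib sum_distrib_left[symmetric] by algebra
    qed
    \<comment> \<open>\<open>drift_le\<close> holds for every configuration, so it is applied at
      each outcome with \<open>l = lam k\<close> and then integrated.\<close>
    also have "\<dots> \<le> \<epsilon> k * (\<integral>\<omega>. - (\<kappa> / 2) * (\<Sum>i\<in>UNIV. (norm (x k i \<omega> - mean_x k \<omega>))\<^sup>2)
            - 2 * lam k * m * (global_f (mean_x k \<omega>) - global_f xopt)
            + 2 * m * C\<^sup>2 / \<kappa> * (lam k)\<^sup>2 \<partial>M)"
      unfolding m_def using pos[of k] ints int_dir int_dis global_f_mean_x_integrable
      by (intro mult_left_mono integral_mono drift_le \<kappa>) auto
    also have "\<dots> = - (\<kappa> / 2 * (\<epsilon> k * disagreement k)) - 2 * m * (\<epsilon> k * lam k * gap k)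
        + 2 * m * C\<^sup>2 / \<kappa> * (\<epsilon> k * (lam k)\<^sup>2)"
      using int_dis global_f_mean_x_integrable
      by (simp add: disagreement_def gap_def prob_space algebra_simps)
    finally have drift: "- 2 * (\<Sum>i\<in>UNIV. \<integral>\<omega>. (x k i \<omega> - xopt) \<bullet> d i \<omega> \<partial>M)
        \<le> - (\<kappa> / 2 * (\<epsilon> k * disagreement k)) - 2 * m * (\<epsilon> k * lam k * gap k)
        + 2 * m * C\<^sup>2 / \<kappa> * (\<epsilon> k * (lam k)\<^sup>2)" .

    have p_le: "(\<integral>\<omega>. (norm (p i \<omega>))\<^sup>2 \<partial>M) \<le> K * (B * (2 * distance_sq k + 2 * m * (norm xopt)\<^sup>2))" for i
    proof -
      have "(\<integral>\<omega>. (norm (p i \<omega>))\<^sup>2 \<partial>M) \<le> (\<integral>\<omega>. K * (\<Sum>j\<in>UNIV. (norm (quantized k j \<omega>))\<^sup>2) \<partial>M)"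
        unfolding K_def m_def using ints
        by (intro integral_mono) (auto simp: p_def intro: norm_consensus_term_sq_le)
      also have "\<dots> = K * (\<Sum>j\<in>UNIV. \<integral>\<omega>. (norm (quantized k j \<omega>))\<^sup>2 \<partial>M)"
        using ints by simp
      also have "\<dots> \<le> K * (\<Sum>j\<in>UNIV. B * (\<integral>\<omega>. (norm (x k j \<omega>))\<^sup>2 \<partial>M))"
      proof (intro mult_left_mono sum_mono K)
        fix j
        have "(\<integral>\<omega>. (norm (quantized k j \<omega>))\<^sup>2 \<partial>M) \<le> 2 * (\<beta> + 1) * (\<integral>\<omega>. (norm (x k j \<omega>))\<^sup>2 \<partial>M)"
          by (rule quantized_L2(2)[OF x_L2])
        also have "\<dots> \<le> B * (\<integral>\<omega>. (norm (x k j \<omega>))\<^sup>2 \<partial>M)"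
          unfolding B_def by (intro mult_right_mono Bochner_Integration.integral_nonneg) auto
        finally show "(\<integral>\<omega>. (norm (quantized k j \<omega>))\<^sup>2 \<partial>M) \<le> B * (\<integral>\<omega>. (norm (x k j \<omega>))\<^sup>2 \<partial>M)" .
      qed
      also have "\<dots> = K * (B * (\<Sum>j\<in>UNIV. \<integral>\<omega>. (norm (x k j \<omega>))\<^sup>2 \<partial>M))"
        by (simp add: sum_distrib_left)
      also have "\<dots> \<le> K * (B * (2 * distance_sq k + 2 * m * (norm xopt)\<^sup>2))"
        unfolding m_def by (intro mult_left_mono K B sum_second_moment_le)
      finally show ?thesis .
    qed
    have d_le: "(\<integral>\<omega>. (norm (d i \<omega>))\<^sup>2 \<partial>M)
        \<le> 2 * (\<epsilon> k)\<^sup>2 * (K * (B * (2 * distance_sq k + 2 * m * (norm xopt)\<^sup>2)))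
          + 2 * ((\<epsilon> k)\<^sup>2 * (lam k)\<^sup>2) * (2 * \<sigma>\<^sup>2 + 2 * C\<^sup>2)" for i
    proof -
      have "(\<integral>\<omega>. (norm (d i \<omega>))\<^sup>2 \<partial>M) \<le> (\<integral>\<omega>. 2 * (\<epsilon> k)\<^sup>2 * (norm (p i \<omega>))\<^sup>2
          + 2 * ((\<epsilon> k)\<^sup>2 * (lam k)\<^sup>2) * (norm (sampled k i \<omega>))\<^sup>2 \<partial>M)"
      proof (rule integral_mono)
        show "(norm (d i \<omega>))\<^sup>2 \<le> 2 * (\<epsilon> k)\<^sup>2 * (norm (p i \<omega>))\<^sup>2
            + 2 * ((\<epsilon> k)\<^sup>2 * (lam k)\<^sup>2) * (norm (sampled k i \<omega>))\<^sup>2" for \<omega>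
          using norm_add_sq_le[of "\<epsilon> k *\<^sub>R p i \<omega>" "(\<epsilon> k * lam k) *\<^sub>R sampled k i \<omega>"]
          by (simp add: d_def power_mult_distrib)
      qed (use ints in auto)
      also have "\<dots> = 2 * (\<epsilon> k)\<^sup>2 * (\<integral>\<omega>. (norm (p i \<omega>))\<^sup>2 \<partial>M)
          + 2 * ((\<epsilon> k)\<^sup>2 * (lam k)\<^sup>2) * (\<integral>\<omega>. (norm (sampled k i \<omega>))\<^sup>2 \<partial>M)"
        using ints by simp
      also have "\<dots> \<le> 2 * (\<epsilon> k)\<^sup>2 * (K * (B * (2 * distance_sq k + 2 * m * (norm xopt)\<^sup>2)))
          + 2 * ((\<epsilon> k)\<^sup>2 * (lam k)\<^sup>2) * (2 * \<sigma>\<^sup>2 + 2 * C\<^sup>2)"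
        by (intro add_mono mult_left_mono p_le sampled_L2(2)) auto
      finally show ?thesis .
    qed
    have noise: "(\<Sum>i\<in>UNIV. \<integral>\<omega>. (norm (d i \<omega>))\<^sup>2 \<partial>M)
        \<le> m * (2 * (\<epsilon> k)\<^sup>2 * (K * (B * (2 * distance_sq k + 2 * m * (norm xopt)\<^sup>2)))
          + 2 * ((\<epsilon> k)\<^sup>2 * (lam k)\<^sup>2) * (2 * \<sigma>\<^sup>2 + 2 * C\<^sup>2))"
      unfolding m_def by (rule sum_bounded_above) (rule d_le[unfolded m_def])
    have "distance_sq (Suc k) \<le> (1 + a * (\<epsilon> k)\<^sup>2) * distance_sq k
        - (\<kappa> / 2 * (\<epsilon> k * disagreement k) + 2 * m * (\<epsilon> k * lam k * gap k))
        + (2 * m * C\<^sup>2 / \<kappa> * (\<epsilon> k * (lam k)\<^sup>2) + 4 * m\<^sup>2 * K * B * (norm xopt)\<^sup>2 * (\<epsilon> k)\<^sup>2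
          + 2 * m * (2 * \<sigma>\<^sup>2 + 2 * C\<^sup>2) * ((\<epsilon> k)\<^sup>2 * (lam k)\<^sup>2))"
    proof -
      have "m * (2 * (\<epsilon> k)\<^sup>2 * (K * (B * (2 * distance_sq k + 2 * m * (norm xopt)\<^sup>2)))
          + 2 * ((\<epsilon> k)\<^sup>2 * (lam k)\<^sup>2) * (2 * \<sigma>\<^sup>2 + 2 * C\<^sup>2))
        = a * (\<epsilon> k)\<^sup>2 * distance_sq k + 4 * m\<^sup>2 * K * B * (norm xopt)\<^sup>2 * (\<epsilon> k)\<^sup>2
          + 2 * m * (2 * \<sigma>\<^sup>2 + 2 * C\<^sup>2) * ((\<epsilon> k)\<^sup>2 * (lam k)\<^sup>2)"
        unfolding a_def by algebra
      moreover have "(1 + a * (\<epsilon> k)\<^sup>2) * distance_sq k = distance_sq k + a * (\<epsilon> k)\<^sup>2 * distance_sq k"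
        by algebra
      ultimately show ?thesis
        using expand drift noise by linarith
    qed
    also have "2 * m * C\<^sup>2 / \<kappa> * (\<epsilon> k * (lam k)\<^sup>2) + 4 * m\<^sup>2 * K * B * (norm xopt)\<^sup>2 * (\<epsilon> k)\<^sup>2
          + 2 * m * (2 * \<sigma>\<^sup>2 + 2 * C\<^sup>2) * ((\<epsilon> k)\<^sup>2 * (lam k)\<^sup>2)
        \<le> b * (\<epsilon> k * (lam k)\<^sup>2) + b * (\<epsilon> k)\<^sup>2 + b * ((\<epsilon> k)\<^sup>2 * (lam k)\<^sup>2)"
      unfolding b_def using m K B \<kappa>(1) pos[of k] by (intro add_mono mult_right_mono) auto
    finally show ?thesis
      by (simp add: algebra_simps)
  qed
  \<comment> \<open>The Poincare constant is passed on halved.\<close>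
  show ?thesis
    by (rule that[OF _ _ _ step[unfolded m_def]])
       (use m K B \<kappa>(1) in \<open>auto simp: a_def b_def\<close>)
qed

subsection \<open>Summability and the limits\<close>

context
  assumes sum_eps_lam: "filterlim (\<lambda>n. \<Sum>k=1..n. \<epsilon> k * lam k) at_top sequentially"
    and sum_eps2: "summable (\<lambda>k. (\<epsilon> (Suc k))\<^sup>2)"
    and sum_eps_lam2: "summable (\<lambda>k. \<epsilon> (Suc k) * (lam (Suc k))\<^sup>2)"
begin

lemma eps2_summable: "summable (\<lambda>k. (\<epsilon> k)\<^sup>2)"
  using sum_eps2 by (simp only: summable_Suc_iff[of "\<lambda>k. (\<epsilon> k)\<^sup>2"])

lemma eps_lam2_summable: "summable (\<lambda>k. \<epsilon> k * (lam k)\<^sup>2)"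
  using sum_eps_lam2 by (simp only: summable_Suc_iff[of "\<lambda>k. \<epsilon> k * (lam k)\<^sup>2"])

text \<open>Square summability bounds \<open>\<epsilon> k\<close> by \<open>1 + S\<close>, so the
  series is dominated by a multiple of the one with terms
  \<open>\<epsilon> k * (lam k)\<^sup>2\<close>.\<close>

lemma eps2_lam2_summable: "summable (\<lambda>k. (\<epsilon> k)\<^sup>2 * (lam k)\<^sup>2)"
proof (rule summable_comparison_test'[where N=0])
  define S where "S = (\<Sum>k. (\<epsilon> k)\<^sup>2)"
  show "summable (\<lambda>k. (1 + S) * (\<epsilon> k * (lam k)\<^sup>2))"
    by (intro summable_mult eps_lam2_summable)
  fix k
  have "(\<epsilon> k)\<^sup>2 \<le> S"
    unfolding S_def using sum_le_suminf[OF eps2_summable, of "{k}"] by simp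
  moreover have "\<epsilon> k \<le> 1 + (\<epsilon> k)\<^sup>2"
    using sum_squares_bound[of "\<epsilon> k" 1] pos(1)[of k] by simp
  ultimately have "\<epsilon> k * (\<epsilon> k * (lam k)\<^sup>2) \<le> (1 + S) * (\<epsilon> k * (lam k)\<^sup>2)"
    using pos(1)[of k] by (intro mult_right_mono) auto
  then show "norm ((\<epsilon> k)\<^sup>2 * (lam k)\<^sup>2) \<le> (1 + S) * (\<epsilon> k * (lam k)\<^sup>2)"
    using pos(1)[of k] by (simp add: abs_mult power2_eq_square mult_ac)
qed

lemma eps_lam_diverges: "filterlim (\<lambda>t. \<Sum>k=0..t. \<epsilon> k * lam k) at_top sequentially"
proof (rule filterlim_at_top_mono[OF sum_eps_lam], rule always_eventually, rule allI)
  \<comment> \<open>The averages start at 0 and the hypothesis at 1; the extra term is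
    positive.\<close>
  show "(\<Sum>k=1..t. \<epsilon> k * lam k) \<le> (\<Sum>k=0..t. \<epsilon> k * lam k)" for t
    using pos by (intro sum_mono2) (auto simp: less_imp_le)
qed

text \<open>The Robbins-Siegmund lemma gives summability of the combined decrease; both parts are
  nonnegative, so each is dominated by the sum.\<close>

lemma disagreement_gap_summable:
  shows "summable (\<lambda>k. \<epsilon> k * disagreement k)" and "summable (\<lambda>k. \<epsilon> k * lam k * gap k)"
proof -
  obtain \<kappa> a b where ab: "\<kappa> > 0" "a \<ge> 0" "b \<ge> 0" and
    step: "\<And>k. distance_sq (Suc k) \<le> (1 + a * (\<epsilon> k)\<^sup>2) * distance_sq k
      - (\<kappa> * (\<epsilon> k * disagreement k) + 2 * real CARD('m) * (\<epsilon> k * lam k * gap k))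
      + b * ((\<epsilon> k)\<^sup>2 + \<epsilon> k * (lam k)\<^sup>2 + (\<epsilon> k)\<^sup>2 * (lam k)\<^sup>2)"
    using distance_sq_Suc_le by blast
  let ?c = "2 * real CARD('m)"
  let ?u = "\<lambda>k. \<kappa> * (\<epsilon> k * disagreement k) + ?c * (\<epsilon> k * lam k * gap k)"
  have nonneg: "0 \<le> \<epsilon> k" "0 \<le> lam k" "0 \<le> \<epsilon> k * disagreement k" "0 \<le> \<epsilon> k * lam k * gap k" for k
    using pos[of k] disagreement_nonneg[of k] gap_nonneg[of k] by auto
  have u: "summable ?u"
  proof (rule summable_Robbins_Siegmund[where V=distance_sq and a="\<lambda>k. a * (\<epsilon> k)\<^sup>2"
        and b="\<lambda>k. b * ((\<epsilon> k)\<^sup>2 + \<epsilon> k * (lam k)\<^sup>2 + (\<epsilon> k)\<^sup>2 * (lam k)\<^sup>2)"])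
    show "summable (\<lambda>k. a * (\<epsilon> k)\<^sup>2)"
      by (intro summable_mult eps2_summable)
    show "summable (\<lambda>k. b * ((\<epsilon> k)\<^sup>2 + \<epsilon> k * (lam k)\<^sup>2 + (\<epsilon> k)\<^sup>2 * (lam k)\<^sup>2))"
      by (intro summable_mult summable_add eps2_summable eps_lam2_summable eps2_lam2_summable)
  qed (use step ab nonneg distance_sq_nonneg in auto)
  have "summable (\<lambda>k. \<kappa> * (\<epsilon> k * disagreement k))"
    by (rule summable_comparison_test'[OF u, of 0]) (use ab nonneg in auto)
  then show "summable (\<lambda>k. \<epsilon> k * disagreement k)"
    using ab by simp
  have "summable (\<lambda>k. ?c * (\<epsilon> k * lam k * gap k))"
    by (rule summable_comparison_test'[OF u, of 0]) (use ab nonneg in auto)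
  then show "summable (\<lambda>k. \<epsilon> k * lam k * gap k)"
    by simp
qed

text \<open>The first-moment counterpart of \<open>disagreement\<close>, for one agent: Lipschitz
  estimates are linear in the distance to the mean.\<close>

definition deviation :: "'m \<Rightarrow> nat \<Rightarrow> real" where
  "deviation i k = (\<integral>\<omega>. norm (x k i \<omega> - mean_x k \<omega>) \<partial>M)"

lemma deviation_nonneg: "0 \<le> deviation i k"
  unfolding deviation_def by (intro Bochner_Integration.integral_nonneg) simp

lemma x_diff_mean_L2: "L2 M (\<lambda>\<omega>. x k i \<omega> - mean_x k \<omega>)"
  by (intro L2_diff x_L2 mean_x_L2)

text \<open>AM-GM in the form \<open>\<lambda> r \<le> \<lambda>\<^sup>2 + r\<^sup>2\<close>: this is why \<open>\<lambda>\<close> need not be bounded.\<close>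

lemma deviation_summable: "summable (\<lambda>k. \<epsilon> k * lam k * deviation i k)"
proof (rule summable_comparison_test'[where N=0])
  show "summable (\<lambda>k. \<epsilon> k * (lam k)\<^sup>2 + \<epsilon> k * disagreement k)"
    by (intro summable_add eps_lam2_summable disagreement_gap_summable)
  fix k
  have "lam k * deviation i k = (\<integral>\<omega>. lam k * norm (x k i \<omega> - mean_x k \<omega>) \<partial>M)"
    by (simp add: deviation_def)
  also have "\<dots> \<le> (\<integral>\<omega>. (lam k)\<^sup>2 + (norm (x k i \<omega> - mean_x k \<omega>))\<^sup>2 \<partial>M)"
  proof (rule integral_mono)
    show "integrable M (\<lambda>\<omega>. lam k * norm (x k i \<omega> - mean_x k \<omega>))"
      using L2_integrable[OF x_diff_mean_L2] by simp
    show "integrable M (\<lambda>\<omega>. (lam k)\<^sup>2 + (norm (x k i \<omega> - mean_x k \<omega>))\<^sup>2)"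
      using L2_integrable_sq[OF x_diff_mean_L2] by simp
    show "lam k * norm (x k i \<omega> - mean_x k \<omega>) \<le> (lam k)\<^sup>2 + (norm (x k i \<omega> - mean_x k \<omega>))\<^sup>2" for \<omega>
      using sum_squares_bound[of "lam k" "norm (x k i \<omega> - mean_x k \<omega>)"] 
        mult_nonneg_nonneg[OF less_imp_le[OF pos(2)[of k]] norm_ge_zero[of "x k i \<omega> - mean_x k \<omega>"]]
      by linarith
  qed
  also have "\<dots> = (lam k)\<^sup>2 + (\<integral>\<omega>. (norm (x k i \<omega> - mean_x k \<omega>))\<^sup>2 \<partial>M)"
    using L2_integrable_sq[OF x_diff_mean_L2] by (simp add: prob_space)
  also have "\<dots> \<le> (lam k)\<^sup>2 + disagreement k"
    unfolding disagreement_def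
    by (intro add_left_mono member_le_sum[of i UNIV "\<lambda>i. \<integral>\<omega>. (norm (x k i \<omega> - mean_x k \<omega>))\<^sup>2 \<partial>M"])
       auto
  finally have "\<epsilon> k * (lam k * deviation i k) \<le> \<epsilon> k * ((lam k)\<^sup>2 + disagreement k)"
    using pos(1)[of k] by (intro mult_left_mono) auto
  then show "norm (\<epsilon> k * lam k * deviation i k) \<le> \<epsilon> k * (lam k)\<^sup>2 + \<epsilon> k * disagreement k"
    using pos[of k] deviation_nonneg[of i k] by (simp add: algebra_simps)
qed

section \<open>The two gradient limits\<close>

lemma gradient_mean_le:
  "(\<integral>\<omega>. (norm (gradient global_f (mean_x k \<omega>)))\<^sup>2 \<partial>M) \<le> 4 * (\<bar>L\<bar> + 1) * gap k"
  "integrable M (\<lambda>\<omega>. (norm (gradient global_f (mean_x k \<omega>)))\<^sup>2)"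
proof -
  have int: "integrable M (\<lambda>\<omega>. 4 * (\<bar>L\<bar> + 1) * (global_f (mean_x k \<omega>) - global_f xopt))"
    using global_f_mean_x_integrable by simp
  have [measurable]: "mean_x k \<in> borel_measurable M"
    by (rule L2_measurable[OF mean_x_L2])
  have "(\<lambda>\<omega>. gradient global_f (mean_x k \<omega>)) \<in> borel_measurable M"
    unfolding global_gradient average_def[where v="\<lambda>i. gradient (local_f i) _"] by measurable
  from L2_bound[OF int this global_gradient_sq_le]
  show int': "integrable M (\<lambda>\<omega>. (norm (gradient global_f (mean_x k \<omega>)))\<^sup>2)"
    by (rule L2_integrable_sq)
  have "(\<integral>\<omega>. (norm (gradient global_f (mean_x k \<omega>)))\<^sup>2 \<partial>M)
      \<le> (\<integral>\<omega>. 4 * (\<bar>L\<bar> + 1) * (global_f (mean_x k \<omega>) - global_f xopt) \<partial>M)"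
    by (rule integral_mono[OF int' int global_gradient_sq_le])
  then show "(\<integral>\<omega>. (norm (gradient global_f (mean_x k \<omega>)))\<^sup>2 \<partial>M) \<le> 4 * (\<bar>L\<bar> + 1) * gap k"
    by (simp add: gap_def)
qed

lemma summable_weighted_le:
  assumes "summable (\<lambda>k. \<epsilon> k * lam k * h k)" "\<And>k. 0 \<le> g k" "\<And>k. g k \<le> h k"
  shows "summable (\<lambda>k. \<epsilon> k * lam k * g k)"
proof (rule summable_comparison_test'[OF assms(1), of 0])
  fix k
  show "norm (\<epsilon> k * lam k * g k) \<le> \<epsilon> k * lam k * h k"
    using pos[of k] assms(2,3)[of k] by (simp add: mult_left_mono)
qed

lemma gradient_mean_tendsto:
  "(\<lambda>t. (\<Sum>k=0..t. \<epsilon> k * lam k * (\<integral>\<omega>. (norm (gradient global_f (mean_x k \<omega>)))\<^sup>2 \<partial>M))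
    / (\<Sum>k=0..t. \<epsilon> k * lam k)) \<longlonglongrightarrow> 0"
proof (rule weighted_average_tendsto_0[OF eps_lam_diverges], rule summable_weighted_le)
  show "summable (\<lambda>k. \<epsilon> k * lam k * (4 * (\<bar>L\<bar> + 1) * gap k))"
    using summable_mult[OF disagreement_gap_summable(2), of "4 * (\<bar>L\<bar> + 1)"]
    by (simp add: mult_ac)
qed (use gradient_mean_le in \<open>auto intro: Bochner_Integration.integral_nonneg\<close>)

text \<open>The difference of two local gradients is bounded both by \<open>2 * C\<close> and by the
  Lipschitz estimate. Multiplying the two bounds makes its square linear in the distance to the
  mean, and the expectation of that distance is summable with weights
  \<open>\<epsilon> k * lam k\<close>.\<close>

lemma average_gradient_sq_le:
  fixes v :: "'m \<Rightarrow> real^'d"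
  shows "(norm (average (\<lambda>i. gradient (local_f i) (v i))))\<^sup>2
    \<le> 2 * (norm (gradient global_f (average v)))\<^sup>2
      + (\<Sum>i\<in>UNIV. 4 * C * (\<bar>L\<bar> + 1) * norm (v i - average v))"
proof -
  let ?y = "\<lambda>i. gradient (local_f i) (v i) - gradient (local_f i) (average v)"
  have "(norm (?y i))\<^sup>2 \<le> 2 * C * (\<bar>L\<bar> + 1) * norm (v i - average v)" for i
  proof -
    have "norm (?y i) \<le> 2 * C"
      using norm_triangle_ineq4[of "gradient (local_f i) (v i)" "gradient (local_f i) (average v)"]
        norm_local_gradient_le[of i "v i"] norm_local_gradient_le[of i "average v"]
      by linarith
    then have "norm (?y i) * norm (?y i) \<le> 2 * C * ((\<bar>L\<bar> + 1) * norm (v i - average v))"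
      using C_nonneg local_gradient_lipschitz by (intro mult_mono) auto
    then show ?thesis
      by (simp only: power2_eq_square mult.assoc)
  qed
  then have "(\<Sum>i\<in>UNIV. (norm (?y i))\<^sup>2) \<le> (\<Sum>i\<in>UNIV. 2 * C * (\<bar>L\<bar> + 1) * norm (v i - average v))"
    by (rule sum_mono)
  with norm_average_sq_le[of ?y]
  have "(norm (average ?y))\<^sup>2 \<le> (\<Sum>i\<in>UNIV. 2 * C * (\<bar>L\<bar> + 1) * norm (v i - average v))"
    by (rule order_trans)
  moreover have "average (\<lambda>i. gradient (local_f i) (v i)) = gradient global_f (average v) + average ?y"
    unfolding global_gradient average_diff[symmetric] by simp
  moreover have "(\<Sum>i\<in>UNIV. 4 * C * (\<bar>L\<bar> + 1) * norm (v i - average v))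
      = 2 * (\<Sum>i\<in>UNIV. 2 * C * (\<bar>L\<bar> + 1) * norm (v i - average v))"
    unfolding sum_distrib_left by (intro sum.cong refl) simp
  ultimately show ?thesis
    using norm_add_sq_le[of "gradient global_f (average v)" "average ?y"] by simp
qed

lemma average_gradient_tendsto:
  "(\<lambda>t. (\<Sum>k=0..t. \<epsilon> k * lam k *
      (\<integral>\<omega>. (norm (average (\<lambda>i. gradient (local_f i) (x k i \<omega>))))\<^sup>2 \<partial>M))
    / (\<Sum>k=0..t. \<epsilon> k * lam k)) \<longlonglongrightarrow> 0"
proof (rule weighted_average_tendsto_0[OF eps_lam_diverges], rule summable_weighted_le)
  \<comment> \<open>The majorant below combines this with the coefficient 8, twice the 4 from
    \<open>gradient_mean_le\<close>.\<close>
  let ?c = "4 * C * (\<bar>L\<bar> + 1)"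
  have "summable (\<lambda>k. 8 * (\<bar>L\<bar> + 1) * (\<epsilon> k * lam k * gap k)
      + (\<Sum>i\<in>UNIV. ?c * (\<epsilon> k * lam k * deviation i k)))"
    by (intro summable_add summable_sum summable_mult disagreement_gap_summable deviation_summable)
  then show "summable (\<lambda>k. \<epsilon> k * lam k * (8 * (\<bar>L\<bar> + 1) * gap k + (\<Sum>i\<in>UNIV. ?c * deviation i k)))"
    by (simp add: distrib_left sum_distrib_left mult_ac)
  fix k
  show "0 \<le> (\<integral>\<omega>. (norm (average (\<lambda>i. gradient (local_f i) (x k i \<omega>))))\<^sup>2 \<partial>M)"
    by (intro Bochner_Integration.integral_nonneg) simp
  have "(\<integral>\<omega>. (norm (average (\<lambda>i. gradient (local_f i) (x k i \<omega>))))\<^sup>2 \<partial>M)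
    \<le> (\<integral>\<omega>. 2 * (norm (gradient global_f (mean_x k \<omega>)))\<^sup>2
      + (\<Sum>i\<in>UNIV. ?c * norm (x k i \<omega> - mean_x k \<omega>)) \<partial>M)"
    using gradient_mean_le(2) L2_integrable[OF x_diff_mean_L2]
    by (intro integral_mono average_gradient_sq_le L2_integrable_sq L2_average gradient_x_L2) auto
  also have "\<dots> = 2 * (\<integral>\<omega>. (norm (gradient global_f (mean_x k \<omega>)))\<^sup>2 \<partial>M)
      + (\<Sum>i\<in>UNIV. ?c * deviation i k)"
    using gradient_mean_le(2) L2_integrable[OF x_diff_mean_L2] by (simp add: deviation_def)
  also have "\<dots> \<le> 8 * (\<bar>L\<bar> + 1) * gap k + (\<Sum>i\<in>UNIV. ?c * deviation i k)"
    using gradient_mean_le(1)[of k] by (simp add: algebra_simps)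
  finally show "(\<integral>\<omega>. (norm (average (\<lambda>i. gradient (local_f i) (x k i \<omega>))))\<^sup>2 \<partial>M)
    \<le> 8 * (\<bar>L\<bar> + 1) * gap k + (\<Sum>i\<in>UNIV. ?c * deviation i k)" .
qed

text \<open>A sandwich: minimality of \<open>xopt\<close> bounds the expectation below. Above,
  Jensen's inequality passes to the single iterates of agent \<open>p\<close>, and the Lipschitz
  bound compares each with the mean iterate, leaving a weighted average of \<open>h\<close>.\<close>

lemma objective_weighted_average_tendsto:
  "(\<lambda>t. \<integral>\<omega>. global_f ((\<Sum>k=0..t. (\<epsilon> k * lam k) *\<^sub>R x k p \<omega>) /\<^sub>R (\<Sum>k=0..t. \<epsilon> k * lam k)) \<partial>M)
    \<longlonglongrightarrow> global_f xopt"
proof -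
  define y where "y = (\<lambda>t \<omega>. (\<Sum>k=0..t. (\<epsilon> k * lam k) *\<^sub>R x k p \<omega>) /\<^sub>R (\<Sum>k=0..t. \<epsilon> k * lam k))"
  define h where "h = (\<lambda>k. gap k + C * deviation p k)"
  have y_int: "integrable M (\<lambda>\<omega>. global_f (y t \<omega>))" for t
    unfolding y_def by (intro integrable_lipschitz[OF global_lipschitz] L2_scaleR L2_sum x_L2)
  have x_int: "integrable M (\<lambda>\<omega>. global_f (x k p \<omega>))" for k
    by (rule integrable_lipschitz[OF global_lipschitz x_L2])
  have x_le: "(\<integral>\<omega>. global_f (x k p \<omega>) \<partial>M) \<le> global_f xopt + h k" for k
  proof -
    have "(\<integral>\<omega>. global_f (x k p \<omega>) \<partial>M)
        \<le> (\<integral>\<omega>. global_f (mean_x k \<omega>) + C * norm (x k p \<omega> - mean_x k \<omega>) \<partial>M)"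
    proof (rule integral_mono[OF x_int])
      show "global_f (x k p \<omega>) \<le> global_f (mean_x k \<omega>) + C * norm (x k p \<omega> - mean_x k \<omega>)" for \<omega>
        using lipschitz_onD[OF global_lipschitz, of "x k p \<omega>" "mean_x k \<omega>"] by (simp add: dist_norm)
    qed (use global_f_mean_x_integrable L2_integrable[OF x_diff_mean_L2] in simp)
    also have "\<dots> = global_f xopt + h k"
      using global_f_mean_x_integrable L2_integrable[OF x_diff_mean_L2]
      by (simp add: h_def gap_def deviation_def prob_space)
    finally show ?thesis .
  qed
  have A: "(\<Sum>k=0..t. \<epsilon> k * lam k) > 0" for t
    using pos by (intro sum_pos) auto
  have upper: "(\<integral>\<omega>. global_f (y t \<omega>) \<partial>M) - global_f xopt
      \<le> (\<Sum>k=0..t. \<epsilon> k * lam k * h k) / (\<Sum>k=0..t. \<epsilon> k * lam k)" for t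
  proof -
    have "(\<integral>\<omega>. global_f (y t \<omega>) \<partial>M)
        \<le> (\<integral>\<omega>. (\<Sum>k=0..t. \<epsilon> k * lam k * global_f (x k p \<omega>)) / (\<Sum>k=0..t. \<epsilon> k * lam k) \<partial>M)"
      unfolding y_def[abs_def] using pos x_int y_int[unfolded y_def]
      by (intro integral_mono convex_on_weighted_average global_convex) auto
    also have "\<dots> = (\<Sum>k=0..t. \<epsilon> k * lam k * (\<integral>\<omega>. global_f (x k p \<omega>) \<partial>M)) / (\<Sum>k=0..t. \<epsilon> k * lam k)"
      using x_int by simp
    also have "\<dots> \<le> (\<Sum>k=0..t. \<epsilon> k * lam k * (global_f xopt + h k)) / (\<Sum>k=0..t. \<epsilon> k * lam k)"
      using pos A[of t] x_le by (intro divide_right_mono sum_mono mult_left_mono) (auto simp: less_imp_le)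
    also have "\<dots> = global_f xopt + (\<Sum>k=0..t. \<epsilon> k * lam k * h k) / (\<Sum>k=0..t. \<epsilon> k * lam k)"
      using A[of t] by (simp add: distrib_left sum.distrib sum_distrib_right[symmetric] add_divide_distrib)
    finally show ?thesis by simp
  qed
  have lower: "0 \<le> (\<integral>\<omega>. global_f (y t \<omega>) \<partial>M) - global_f xopt" for t
    using integral_mono[of M "\<lambda>_. global_f xopt" "\<lambda>\<omega>. global_f (y t \<omega>)"] y_int global_minimum
    by (simp add: prob_space)
  have "summable (\<lambda>k. \<epsilon> k * lam k * gap k + C * (\<epsilon> k * lam k * deviation p k))"
    by (intro summable_add summable_mult disagreement_gap_summable deviation_summable)
  then have "summable (\<lambda>k. \<epsilon> k * lam k * h k)"
    by (simp add: h_def distrib_left mult_ac)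
  from weighted_average_tendsto_0[OF eps_lam_diverges this]
  have "(\<lambda>t. (\<integral>\<omega>. global_f (y t \<omega>) \<partial>M) - global_f xopt) \<longlonglongrightarrow> 0"
    by (rule tendsto_sandwich[rotated 3, OF _ _ _ tendsto_const]) (use lower upper in auto)
  then show ?thesis
    unfolding y_def by (rule LIM_zero_cancel)
qed

end

end

theorem theorem2:
  fixes M :: "'w measure" and D :: "'m::finite \<Rightarrow> 's measure" and Z :: "'z measure"
    and F :: "'m \<Rightarrow> real^'d \<Rightarrow> 's \<Rightarrow> real"
    and G :: "nat \<Rightarrow> 'm \<Rightarrow> real^'d \<Rightarrow> 's \<Rightarrow> real^'d"
    and Q :: "real^'d \<Rightarrow> 'z \<Rightarrow> real^'d"
    and \<xi> :: "nat \<Rightarrow> 'm \<Rightarrow> 'w \<Rightarrow> 's" and \<zeta> :: "nat \<Rightarrow> 'm \<Rightarrow> 'w \<Rightarrow> 'z"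
    and W :: "real^'m^'m" and \<epsilon> lam :: "nat \<Rightarrow> real"
    and L \<sigma> \<beta> :: real and xopt :: "real^'d"
    and x :: "nat \<Rightarrow> 'm \<Rightarrow> 'w \<Rightarrow> real^'d"
  assumes randomness: "fresh_randomness M D Z \<xi> \<zeta>"
    and grad: "gradient_assumption D F G L \<sigma> xopt"
    and conn: "connectivity_assumption W"
    and quant: "quantizer_assumption Z Q \<beta>"
    and conv: "\<And>i. convex_on UNIV (local_objective D F i)"
    and pos: "\<And>k. \<epsilon> k > 0" "\<And>k. lam k > 0"
    and sum_eps_lam: "filterlim (\<lambda>n. \<Sum>k=1..n. \<epsilon> k * lam k) at_top sequentially"
    and sum_eps2: "summable (\<lambda>k. (\<epsilon> (Suc k))\<^sup>2)"
    and sum_eps_lam2: "summable (\<lambda>k. \<epsilon> (Suc k) * (lam (Suc k))\<^sup>2)"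
    and x_def: "x = iterate W \<epsilon> lam Q G \<xi> \<zeta>"
  shows "((\<lambda>t. (\<Sum>k=0..t. \<epsilon> k * lam k *
              (\<integral>\<omega>. (norm (gradient (objective D F) (average (\<lambda>i. x k i \<omega>))))\<^sup>2 \<partial>M))
            / (\<Sum>k=0..t. \<epsilon> k * lam k)) \<longlonglongrightarrow> 0)
       \<and> ((\<lambda>t. (\<Sum>k=0..t. \<epsilon> k * lam k *
              (\<integral>\<omega>. (norm (average (\<lambda>i. gradient (local_objective D F i) (x k i \<omega>))))\<^sup>2 \<partial>M))
            / (\<Sum>k=0..t. \<epsilon> k * lam k)) \<longlonglongrightarrow> 0)
       \<and> (summable (\<lambda>k. \<epsilon> (Suc k) powr (3/2) * lam (Suc k)) \<longrightarrow>
          (\<forall>p. (\<lambda>t. \<integral>\<omega>. objective D F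
              ((\<Sum>k=0..t. (\<epsilon> k * lam k) *\<^sub>R x k p \<omega>) /\<^sub>R (\<Sum>k=0..t. \<epsilon> k * lam k)) \<partial>M)
            \<longlonglongrightarrow> objective D F xopt))"
proof -
  have "\<forall>i. \<exists>c. c-lipschitz_on UNIV (local_objective D F i)"
    using grad by (simp add: gradient_assumption_def)
  then obtain c where c: "\<And>i. (c i)-lipschitz_on UNIV (local_objective D F i)"
    by metis
  \<comment> \<open>There are finitely many agents, so the maximum of their constants serves as the
    common \<open>C\<close> of the locale.\<close>
  have "(Max (range c))-lipschitz_on UNIV (local_objective D F i)" for i
    by (rule lipschitz_on_le[OF c]) simp
  then interpret quantized_gradient_method M D Z F G Q \<xi> \<zeta> W \<epsilon> lam L \<sigma> \<beta> "Max (range c)" xopt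
    using assms by unfold_locales auto
  show ?thesis
    unfolding x_def
    using gradient_mean_tendsto[OF sum_eps_lam sum_eps2 sum_eps_lam2]
      average_gradient_tendsto[OF sum_eps_lam sum_eps2 sum_eps_lam2]
      objective_weighted_average_tendsto[OF sum_eps_lam sum_eps2 sum_eps_lam2]
    by blast
qed

end
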